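(* Let $(a,\delta)\in\overline K\times\Lambda$ and let $\mu\in\mathcal V$ be the restriction of $v_{a,\delta}$ to $K[x]$. Let $$B(a,\delta)=\bigsqcup_{i\in I}B^\circ(a_i,\delta)$$ be the partition of $B(a,\delta)$ as a disjoint union of open balls of radius $\delta$. Then $$\operatorname{KP}(\mu)=\bigcup_{i\in I}\operatorname{KP}_i(\mu),\qquad\text{where }\ \operatorname{KP}_i(\mu):=p_K\left(\operatorname{Min}_K B^\circ(a_i,\delta)\right).$$
   Context: $(K,v)$ is a valued field, $\overline K$ an algebraic closure of $K$, and $v$ also denotes a fixed extension of $v$ to $\overline K$. Put $\Gamma=v\overline K$ and fix an embedding $\Gamma\hookrightarrow\Lambda$ into a divisible (totally) ordered abelian group $\Lambda$. $\mathcal V$ is the set of all $\Lambda$-valued valuations on $K(x)$ whose restriction to $K$ is $v$, identified with valuations $\mu:K[x]\to\Lambda\cup\{\infty\}$ with $\mu^{-1}(\infty)=\{0\}$ and $\mu_{\mid K}=v$. For $(a,\delta)\in\overline K\times\Lambda$: $B(a,\delta)=\{b\in\overline K\mid v(b-a)\ge\delta\}$, $B^\circ(a,\delta)=\{b\in\overline K\mid v(b-a)>\delta\}$, and $v_{a,\delta}$ is the valuation on $\overline K[x]$ given by $v_{a,\delta}\left(\sum_k a_k(x-a)^k\right)=\min_k\{v(a_k)+k\delta\}$. For $c\in\overline K$, $p_K(c)\in K[x]$ is its minimal polynomial over $K$, and $\deg_K c=\deg p_K(c)$. For $S\subseteq\overline K$: $p_K(S)=\{p_K(c)\mid c\in S\}$,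 $\deg_K S=\min\{\deg_K c\mid c\in S\}$, $\operatorname{Min}_K S=\{c\in S\mid\deg_K c=\deg_K S\}$. The graded algebra of $\mu\in\mathcal V$ is $\mathcal G_\mu=\bigoplus_{\alpha\in\Gamma_\mu}\mathcal P_\alpha/\mathcal P_\alpha^+$, where $\Gamma_\mu$ is the value group of $\mu$, $\mathcal P_\alpha=\{f\in K[x]\mid\mu(f)\ge\alpha\}$, $\mathcal P_\alpha^+=\{f\in K[x]\mid\mu(f)>\alpha\}$. For nonzero $f\in K[x]$, $\operatorname{in}_\mu f\in\mathcal G_\mu$ is the image of $f$ in $\mathcal P_{\mu(f)}/\mathcal P_{\mu(f)}^+$. A monic $\phi\in K[x]$ is a key polynomial for $\mu$ if $(\operatorname{in}_\mu\phi)\mathcal G_\mu$ is a homogeneous prime ideal containing no $\operatorname{in}_\mu f$ with $f\ne0$, $\deg f<\deg\phi$. $\operatorname{KP}(\mu)$ is the set of all key polynomials for $\mu$. *)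

theory Defs
  imports
    "HOL-Computational_Algebra.Polynomial"
    "HOL-Library.Set_Algebras"
    "HOL-Library.FuncSet"
    "HOL-Library.Disjoint_Sets"
    "HOL-Algebra.Ideal"
begin

text \<open>The extended group $\Lambda \cup \{\infty\}$.\<close>

datatype 'g ext_val = Fin 'g | Infty

instantiation ext_val :: (linorder) linorder
begin

fun less_eq_ext_val :: "'a ext_val \<Rightarrow> 'a ext_val \<Rightarrow> bool" where
  "Fin x \<le> Fin y \<longleftrightarrow> x \<le> y"
| "Infty \<le> Fin y \<longleftrightarrow> False"
| "_ \<le> Infty \<longleftrightarrow> True"

definition less_ext_val :: "'a ext_val \<Rightarrow> 'a ext_val \<Rightarrow> bool" where
  "x < y \<longleftrightarrow> x \<le> y \<and> \<not> y \<le> (x :: 'a ext_val)"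

instance
proof
  fix x y z :: "'a ext_val"
  show "x < y \<longleftrightarrow> x \<le> y \<and> \<not> y \<le> x" by (simp add: less_ext_val_def)
  show "x \<le> x" by (cases x) auto
  show "x \<le> y \<Longrightarrow> y \<le> z \<Longrightarrow> x \<le> z" by (cases x; cases y; cases z) auto
  show "x \<le> y \<Longrightarrow> y \<le> x \<Longrightarrow> x = y" by (cases x; cases y) auto
  show "x \<le> y \<or> y \<le> x" by (cases x; cases y) auto
qed

end

instantiation ext_val :: (comm_monoid_add) comm_monoid_add
begin

definition zero_ext_val :: "'a ext_val" where "0 = Fin 0"

fun plus_ext_val :: "'a ext_val \<Rightarrow> 'a ext_val \<Rightarrow> 'a ext_val" where
  "Fin x + Fin y = Fin (x + y)"
| "Infty + _ = Infty"
| "_ + Infty = Infty"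

instance
proof
  fix x y z :: "'a ext_val"
  show "x + y + z = x + (y + z)" by (cases x; cases y; cases z) (auto simp: add.assoc)
  show "x + y = y + x" by (cases x; cases y) (auto simp: add.commute)
  show "0 + x = x" by (cases x) (auto simp: zero_ext_val_def)
qed

end

abbreviation nat_mult :: "nat \<Rightarrow> 'g \<Rightarrow> 'g::comm_monoid_add" where
  "nat_mult n x \<equiv> (\<Sum>i<n. x)"

definition valuation :: "('r::comm_ring_1 \<Rightarrow> 'g::linordered_ab_group_add ext_val) \<Rightarrow> bool" where
  "valuation v \<longleftrightarrow>
     (\<forall>x. v x = Infty \<longleftrightarrow> x = 0) \<and>
     (\<forall>x y. v (x * y) = v x + v y) \<and>
     (\<forall>x y. min (v x) (v y) \<le> v (x + y))"

text \<open>The algebraically closed type \<open>'l\<close>, with the embedding \<open>\<iota>\<close> of the field \<open>'k\<close>, is an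
  algebraic closure of \<open>'k\<close>. Polynomials over \<open>'k\<close> are viewed over \<open>'l\<close> by
  \<open>map_poly \<iota>\<close>.\<close>

definition is_algebraic_closure :: "('k::field \<Rightarrow> 'l::alg_closed_field) \<Rightarrow> bool" where
  "is_algebraic_closure \<iota> \<longleftrightarrow>
     \<iota> 1 = 1 \<and> (\<forall>x y. \<iota> (x + y) = \<iota> x + \<iota> y) \<and> (\<forall>x y. \<iota> (x * y) = \<iota> x * \<iota> y) \<and>
     (\<forall>c. \<exists>p. p \<noteq> 0 \<and> poly (map_poly \<iota> p) c = 0)"

text \<open>The set $\mathcal V$: a valuation on $K(x)$ extending that of $K$ is given by its
  restriction to $K[x]$, on which only $0$ has value $\infty$.\<close>

definition valuations_over ::
    "('k::field \<Rightarrow> 'g::linordered_ab_group_add ext_val) \<Rightarrow> ('k poly \<Rightarrow> 'g ext_val) set" where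
  "valuations_over vK = {\<mu>. valuation \<mu> \<and> (\<forall>c. \<mu> [:c:] = vK c)}"

definition closed_ball ::
    "('l::field \<Rightarrow> 'g::linordered_ab_group_add ext_val) \<Rightarrow> 'l \<Rightarrow> 'g \<Rightarrow> 'l set" where
  "closed_ball v a \<delta> = {b. v (b - a) \<ge> Fin \<delta>}"

definition open_ball ::
    "('l::field \<Rightarrow> 'g::linordered_ab_group_add ext_val) \<Rightarrow> 'l \<Rightarrow> 'g \<Rightarrow> 'l set" where
  "open_ball v a \<delta> = {b. v (b - a) > Fin \<delta>}"

text \<open>The valuation $v_{a,\delta}$. The coefficients of the $(x-a)$-expansion of \<open>f\<close> are the
  coefficients of $f(x+a)$, see \<open>shift_expansion\<close>.\<close>

definition ball_valuation ::
    "('l::field \<Rightarrow> 'g::linordered_ab_group_add ext_val) \<Rightarrow> 'l \<Rightarrow> 'g \<Rightarrow> 'l poly \<Rightarrow> 'g ext_val" where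
  "ball_valuation v a \<delta> f =
     Min ((\<lambda>k. v (coeff (f \<circ>\<^sub>p [:a, 1:]) k) + Fin (nat_mult k \<delta>)) ` {..degree f})"

lemma shift_expansion:
  fixes f :: "'l::field poly"
  shows "f = (\<Sum>k\<le>degree f. smult (coeff (f \<circ>\<^sub>p [:a, 1:]) k) ([:- a, 1:] ^ k))"
proof -
  define g where "g = f \<circ>\<^sub>p [:a, 1:]"
  have "f = g \<circ>\<^sub>p [:- a, 1:]"
    by (simp add: g_def pcompose_assoc[symmetric] pcompose_pCons pcompose_idR)
  also have "\<dots> = (\<Sum>k\<le>degree g. smult (coeff g k) ([:- a, 1:] ^ k))"
    by (simp add: pcompose_altdef poly_altdef coeff_map_poly degree_map_poly)
  also have "degree g = degree f" by (simp add: g_def degree_pcompose)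
  finally show ?thesis by (simp add: g_def)
qed

text \<open>The minimal polynomial $p_K(c)$, then $\deg_K c$, $\deg_K S$ and
  $\operatorname{Min}_K S$.\<close>

definition min_poly :: "('k::field \<Rightarrow> 'l::field) \<Rightarrow> 'l \<Rightarrow> 'k poly" where
  "min_poly \<iota> c = (THE p. lead_coeff p = 1 \<and> poly (map_poly \<iota> p) c = 0 \<and>
     (\<forall>q. q \<noteq> 0 \<and> poly (map_poly \<iota> q) c = 0 \<longrightarrow> degree p \<le> degree q))"

definition deg_elt :: "('k::field \<Rightarrow> 'l::field) \<Rightarrow> 'l \<Rightarrow> nat" where
  "deg_elt \<iota> c = degree (min_poly \<iota> c)"

definition deg_set :: "('k::field \<Rightarrow> 'l::field) \<Rightarrow> 'l set \<Rightarrow> nat" where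
  "deg_set \<iota> S = Inf (deg_elt \<iota> ` S)"

definition Min_set :: "('k::field \<Rightarrow> 'l::field) \<Rightarrow> 'l set \<Rightarrow> 'l set" where
  "Min_set \<iota> S = {c \<in> S. deg_elt \<iota> c = deg_set \<iota> S}"

text \<open>$\Gamma_\mu$: the values of $\mu$ on nonzero rational functions $f/g$.\<close>

definition value_group :: "('k::field poly \<Rightarrow> 'g::linordered_ab_group_add ext_val) \<Rightarrow> 'g set" where
  "value_group \<mu> = {\<alpha> - \<beta> |\<alpha> \<beta> f g. \<mu> f = Fin \<alpha> \<and> \<mu> g = Fin \<beta>}"

text \<open>$\mathcal P_\alpha$ and $\mathcal P_\alpha^+$.\<close>

definition Pge :: "('k::field poly \<Rightarrow> 'g::linordered_ab_group_add ext_val) \<Rightarrow> 'g \<Rightarrow> 'k poly set" where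
  "Pge \<mu> \<alpha> = {f. \<mu> f \<ge> Fin \<alpha>}"

definition Pgt :: "('k::field poly \<Rightarrow> 'g::linordered_ab_group_add ext_val) \<Rightarrow> 'g \<Rightarrow> 'k poly set" where
  "Pgt \<mu> \<alpha> = {f. \<mu> f > Fin \<alpha>}"

text \<open>An element of the graded algebra is a finitely supported family of cosets
  $g_\alpha \in \mathcal P_\alpha/\mathcal P_\alpha^+$, $\alpha\in\Gamma_\mu$ (and
  \<open>undefined\<close> outside $\Gamma_\mu$). Sums and products of cosets are the elementwise ones of
  \<open>Set_Algebras\<close>. An elementwise product of two cosets is in general only a
  nonempty subset of the product coset, and the empty sum of sets is \<open>{0}\<close>; adding
  $\mathcal P_\gamma^+$ turns the sum into the full coset.\<close>

definition supp :: "('k::field poly \<Rightarrow> 'g::linordered_ab_group_add ext_val) \<Rightarrow>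
    ('g \<Rightarrow> 'k poly set) \<Rightarrow> 'g set" where
  "supp \<mu> g = {\<alpha> \<in> value_group \<mu>. g \<alpha> \<noteq> Pgt \<mu> \<alpha>}"

definition graded_algebra :: "('k::field poly \<Rightarrow> 'g::linordered_ab_group_add ext_val) \<Rightarrow>
    ('g \<Rightarrow> 'k poly set) ring" where
  "graded_algebra \<mu> =
     \<lparr>carrier = {g \<in> \<Pi>\<^sub>E \<alpha>\<in>value_group \<mu>. {f +o Pgt \<mu> \<alpha> |f. f \<in> Pge \<mu> \<alpha>}. finite (supp \<mu> g)},
      monoid.mult = (\<lambda>g h. \<lambda>\<gamma>\<in>value_group \<mu>. (\<Sum>\<alpha>\<in>supp \<mu> g. g \<alpha> * h (\<gamma> - \<alpha>)) + Pgt \<mu> \<gamma>),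
      one = (\<lambda>\<alpha>\<in>value_group \<mu>. if \<alpha> = 0 then 1 +o Pgt \<mu> 0 else Pgt \<mu> \<alpha>),
      zero = (\<lambda>\<alpha>\<in>value_group \<mu>. Pgt \<mu> \<alpha>),
      add = (\<lambda>g h. \<lambda>\<alpha>\<in>value_group \<mu>. g \<alpha> + h \<alpha>)\<rparr>"

text \<open>\<open>in_form \<mu> f\<close> is $\operatorname{in}_\mu f$, meant for nonzero \<open>f\<close>.\<close>

definition in_form :: "('k::field poly \<Rightarrow> 'g::linordered_ab_group_add ext_val) \<Rightarrow>
    'k poly \<Rightarrow> 'g \<Rightarrow> 'k poly set" where
  "in_form \<mu> f = (\<lambda>\<alpha>\<in>value_group \<mu>. if Fin \<alpha> = \<mu> f then f +o Pgt \<mu> \<alpha> else Pgt \<mu> \<alpha>)"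

definition component :: "('k::field poly \<Rightarrow> 'g::linordered_ab_group_add ext_val) \<Rightarrow>
    'g \<Rightarrow> ('g \<Rightarrow> 'k poly set) \<Rightarrow> 'g \<Rightarrow> 'k poly set" where
  "component \<mu> \<alpha> g = (\<lambda>\<beta>\<in>value_group \<mu>. if \<beta> = \<alpha> then g \<alpha> else Pgt \<mu> \<beta>)"

definition homogeneous_ideal :: "('k::field poly \<Rightarrow> 'g::linordered_ab_group_add ext_val) \<Rightarrow>
    ('g \<Rightarrow> 'k poly set) set \<Rightarrow> bool" where
  "homogeneous_ideal \<mu> J \<longleftrightarrow> ideal J (graded_algebra \<mu>) \<and>
     (\<forall>g\<in>J. \<forall>\<alpha>\<in>value_group \<mu>. component \<mu> \<alpha> g \<in> J)"

definition is_key_polynomial ::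
    "('k::field poly \<Rightarrow> 'g::linordered_ab_group_add ext_val) \<Rightarrow> 'k poly \<Rightarrow> bool" where
  "is_key_polynomial \<mu> \<phi> \<longleftrightarrow> lead_coeff \<phi> = 1 \<and>
     (let J = PIdl\<^bsub>graded_algebra \<mu>\<^esub> (in_form \<mu> \<phi>)
      in homogeneous_ideal \<mu> J \<and> primeideal J (graded_algebra \<mu>) \<and>
         (\<forall>f. f \<noteq> 0 \<and> degree f < degree \<phi> \<longrightarrow> in_form \<mu> f \<notin> J))"

definition KP :: "('k::field poly \<Rightarrow> 'g::linordered_ab_group_add ext_val) \<Rightarrow> 'k poly set" where
  "KP \<mu> = {\<phi>. is_key_polynomial \<mu> \<phi>}"

end

theory Submission
  imports Defs "HOL-Library.Poly_Mapping"
begin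

text \<open>For $c \in B(a,\delta)$ one has $\mu(f) \le v(f(c))$ for all $f \in K[x]$, with equality if
  $f \ne 0$ has no root in $B^\circ(c,\delta)$ and strict inequality if it has one.

  If $c$ has minimal degree in its open ball, division by $\phi = p_K(c)$ therefore shows that
  the ideal generated by $\operatorname{in}_\mu\phi$ consists of the elements whose component
  of each degree $\gamma$ is the class of some $f$ with $v(f(c)) > \gamma$. This ideal is prime
  because $f \mapsto v(f(c))$ is multiplicative, so $\phi$ is a key polynomial.

  Conversely let $\phi$ be a key polynomial. If it had no root in $B(a,\delta)$, take $c$ of
  minimal degree in $B(a,\delta)$ and $s$ of smaller degree with $(s\phi)(c) = 1$. As $s\phi$ has
  no root in $B(a,\delta)$, the constant term of its expansion at $c$ strictly dominates, so
  $\mu(s\phi - 1) > 0$ and $\operatorname{in}_\mu\phi$ is a unit, which is absurd. So $\phi$ has a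
  root $d$ in some $B^\circ(a_i,\delta)$. For $c$ of minimal degree there and $Q = p_K(c)$,
  division gives $\operatorname{in}_\mu\phi = \operatorname{in}_\mu h \cdot
  \operatorname{in}_\mu Q$ with $\deg h < \deg\phi$. Primality and minimality of $\phi$ force
  $\deg\phi \le \deg Q$, so $d$ also has minimal degree and $\phi = p_K(d)$.\<close>

section \<open>Valuations\<close>

lemma ext_val_less_simps [simp]:
  "Fin x < Fin y \<longleftrightarrow> x < (y :: 'g::linorder)" "Fin x < Infty" "\<not> Infty < z"
  "z \<le> Infty" "Infty \<le> z \<longleftrightarrow> z = Infty"
  by (auto simp: less_ext_val_def; cases z; simp)+

lemma neq_Infty_less: "z \<noteq> Infty \<Longrightarrow> z < Infty"
  by (cases z) auto

lemma ext_val_add_Infty [simp]: "z + Infty = Infty"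
  by (cases z) auto

lemma ext_val_add_eq_Infty [simp]: "x + y = Infty \<longleftrightarrow> x = Infty \<or> y = Infty"
  by (cases x; cases y) auto

instance ext_val :: (linordered_ab_group_add) ordered_comm_monoid_add
proof
  fix x y z :: "'a ext_val"
  assume "x \<le> y" then show "z + x \<le> z + y" by (cases x; cases y; cases z) auto
qed

lemma ext_val_add_less_mono:
  fixes x y z w :: "'g::linordered_ab_group_add ext_val"
  assumes "x < y" "z \<le> w" "z \<noteq> Infty"
  shows "x + z < y + w" "z + x < w + y"
  using assms by (cases x; cases y; cases z; cases w; auto intro: add_less_le_mono add_le_less_mono)+

lemma nat_mult_Suc [simp]: "nat_mult (Suc k) \<delta> = nat_mult k \<delta> + \<delta>"
  by simp

lemma Fin_diff_le_iff:
  fixes \<gamma> \<delta> :: "'g::linordered_ab_group_add"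
  shows "Fin (\<gamma> - \<delta>) \<le> z \<longleftrightarrow> Fin \<gamma> \<le> z + Fin \<delta>"
  by (cases z) (auto simp: algebra_simps)

locale valued_ring =
  fixes v :: "'r::comm_ring_1 \<Rightarrow> 'g::linordered_ab_group_add ext_val"
  assumes valuation: "valuation v"
begin

lemma eq_Infty_iff [simp]: "v x = Infty \<longleftrightarrow> x = 0"
  using valuation by (auto simp: valuation_def)

lemma zero [simp]: "v 0 = Infty"
  by simp

lemma mult: "v (x * y) = v x + v y"
  using valuation by (auto simp: valuation_def)

lemma add_ge: "z \<le> v x \<Longrightarrow> z \<le> v y \<Longrightarrow> z \<le> v (x + y)"
  using valuation unfolding valuation_def by (meson min.boundedI order_trans)

lemma add_gt: "z < v x \<Longrightarrow> z < v y \<Longrightarrow> z < v (x + y)"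
  using valuation unfolding valuation_def by (meson min_less_iff_conj less_le_trans)

lemma one [simp]: "v 1 = Fin 0"
proof -
  have "v 1 + v 1 = v 1" "v 1 \<noteq> Infty" using mult[of 1 1] by auto
  then show ?thesis by (cases "v 1") auto
qed

lemma minus [simp]: "v (- x) = v x"
proof -
  have "v (- 1) + v (- 1) = Fin 0" using mult[of "- 1" "- 1"] by simp
  then have "v (- 1) = Fin 0"
    by (cases "v (- 1)") auto
  then show ?thesis using mult[of "- 1" x] by (cases "v x") auto
qed

lemma diff_ge: "z \<le> v x \<Longrightarrow> z \<le> v y \<Longrightarrow> z \<le> v (x - y)"
  using add_ge[of z x "- y"] by simp

lemma diff_gt: "z < v x \<Longrightarrow> z < v y \<Longrightarrow> z < v (x - y)"
  using add_gt[of z x "- y"] by simp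

lemma diff_commute: "v (x - y) = v (y - x)"
  using minus[of "x - y"] by simp

lemma ex_Fin: "x \<noteq> 0 \<Longrightarrow> \<exists>\<alpha>. v x = Fin \<alpha>"
  by (cases "v x") auto

text \<open>If \<open>v y\<close> exceeded \<open>v x\<close>, then \<open>x = (x - y) + y\<close>
  would be a sum of two elements of value greater than \<open>v x\<close>.\<close>

lemma eq_of_diff_gt:
  assumes "v (x - y) > v x" shows "v y = v x"
proof (rule antisym)
  show "v y \<le> v x"
  proof (rule ccontr)
    assume "\<not> v y \<le> v x"
    then have "v x < v x" using add_gt[of "v x" "x - y" y] assms by (simp add: not_le)
    then show False by simp
  qed
  show "v x \<le> v y" using diff_ge[of "v x" x "x - y"] assms by auto
qed

lemma sum_ge: "(\<And>i. i \<in> A \<Longrightarrow> z \<le> v (f i)) \<Longrightarrow> z \<le> v (sum f A)"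
  by (induction A rule: infinite_finite_induct) (auto intro: add_ge)

lemma sum_gt: "z \<noteq> Infty \<Longrightarrow> (\<And>i. i \<in> A \<Longrightarrow> z < v (f i)) \<Longrightarrow> z < v (sum f A)"
proof (induction A rule: infinite_finite_induct)
  case (insert x F)
  then show ?case by (simp add: add_gt)
qed (simp_all add: neq_Infty_less)

end

section \<open>The valuation of a ball\<close>

context valued_ring
begin

text \<open>A lower bound for the Gauss valuation in which the variable has value
  \<open>\<delta>\<close>. Quantifying over all \<open>k\<close>, instead of taking a minimum up to
  the degree, suits induction along \<open>pCons\<close> and covers the zero polynomial.\<close>

definition gauss_ge :: "'g \<Rightarrow> 'g \<Rightarrow> 'r poly \<Rightarrow> bool" where
  "gauss_ge \<delta> \<gamma> F \<longleftrightarrow> (\<forall>k. Fin \<gamma> \<le> v (coeff F k) + Fin (nat_mult k \<delta>))"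

lemma gauss_ge_0 [simp]: "gauss_ge \<delta> \<gamma> 0"
  by (simp add: gauss_ge_def)

lemma gauss_ge_pCons: "gauss_ge \<delta> \<gamma> (pCons c F) \<longleftrightarrow> Fin \<gamma> \<le> v c \<and> gauss_ge \<delta> (\<gamma> - \<delta>) F"
proof -
  have "Fin \<gamma> \<le> v (coeff F k) + Fin (nat_mult (Suc k) \<delta>) \<longleftrightarrow>
      Fin (\<gamma> - \<delta>) \<le> v (coeff F k) + Fin (nat_mult k \<delta>)" for k
    unfolding Fin_diff_le_iff by (simp only: add.assoc plus_ext_val.simps nat_mult_Suc)
  moreover have "gauss_ge \<delta> \<gamma> (pCons c F) \<longleftrightarrow> Fin \<gamma> \<le> v c + Fin (nat_mult 0 \<delta>) \<and>
      (\<forall>k. Fin \<gamma> \<le> v (coeff F k) + Fin (nat_mult (Suc k) \<delta>))"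
    unfolding gauss_ge_def
  proof safe
    fix k assume "Fin \<gamma> \<le> v c + Fin (nat_mult 0 \<delta>)"
      "\<forall>k. Fin \<gamma> \<le> v (coeff F k) + Fin (nat_mult (Suc k) \<delta>)"
    then show "Fin \<gamma> \<le> v (coeff (pCons c F) k) + Fin (nat_mult k \<delta>)"
      by (cases k) (auto simp only: coeff_pCons_0 coeff_pCons_Suc)
  qed (metis coeff_pCons_0, metis coeff_pCons_Suc)
  moreover have "v c + Fin (nat_mult 0 \<delta>) = v c"
    by (cases "v c") auto
  ultimately show ?thesis
    unfolding gauss_ge_def by presburger
qed

lemma gauss_ge_add:
  assumes "gauss_ge \<delta> \<gamma> F" "gauss_ge \<delta> \<gamma> G" shows "gauss_ge \<delta> \<gamma> (F + G)"
proof -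
  have "Fin (\<gamma> - nat_mult k \<delta>) \<le> v (coeff (F + G) k)" for k
    using assms unfolding gauss_ge_def Fin_diff_le_iff[symmetric] by (auto intro: add_ge)
  then show ?thesis by (simp add: gauss_ge_def Fin_diff_le_iff)
qed

text \<open>The scalar contributes exactly the \<open>\<delta>\<close> that
  \<open>gauss_ge_pCons\<close> loses when a factor of the variable is stripped off.\<close>

lemma gauss_ge_smult:
  assumes "gauss_ge \<delta> (\<gamma> - \<delta>) F" "Fin \<delta> \<le> v e" shows "gauss_ge \<delta> \<gamma> (smult e F)"
  unfolding gauss_ge_def
proof
  fix k
  have "Fin (\<gamma> - \<delta>) + Fin \<delta> \<le> (v (coeff F k) + Fin (nat_mult k \<delta>)) + v e"
    using assms by (intro add_mono) (auto simp: gauss_ge_def)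
  then show "Fin \<gamma> \<le> v (coeff (smult e F) k) + Fin (nat_mult k \<delta>)"
    by (simp add: mult ac_simps)
qed

text \<open>Horner's scheme: the translate is \<open>c + (x + e) * H\<close> with \<open>H\<close>
  the translate of the tail, and both the variable and \<open>e\<close> contribute at least
  \<open>\<delta>\<close>.\<close>

lemma gauss_ge_translate:
  assumes "Fin \<delta> \<le> v e" "gauss_ge \<delta> \<gamma> F" shows "gauss_ge \<delta> \<gamma> (F \<circ>\<^sub>p [:e, 1:])"
  using assms(2)
proof (induction F arbitrary: \<gamma>)
  case (pCons c F)
  let ?H = "F \<circ>\<^sub>p [:e, 1:]"
  have H: "gauss_ge \<delta> (\<gamma> - \<delta>) ?H" and c: "Fin \<gamma> \<le> v c"
    using pCons by (auto simp: gauss_ge_pCons)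
  have "pCons c F \<circ>\<^sub>p [:e, 1:] = [:c:] + (smult e ?H + pCons 0 ?H)"
    by (simp add: pcompose_pCons)
  also have "gauss_ge \<delta> \<gamma> \<dots>"
    using H c assms(1) by (intro gauss_ge_add gauss_ge_smult) (auto simp: gauss_ge_pCons)
  finally show ?case .
qed simp

end

section \<open>Expansions at a centre and independence of the centre\<close>

locale valued_field = valued_ring v for v :: "'l::field \<Rightarrow> 'g::linordered_ab_group_add ext_val"
begin

abbreviation recenter :: "'l poly \<Rightarrow> 'l \<Rightarrow> 'l poly" where
  "recenter f c \<equiv> f \<circ>\<^sub>p [:c, 1:]"

lemma poly_recenter_0 [simp]: "poly (recenter f c) 0 = poly f c"
  by (simp add: poly_pcompose)

lemma recenter_recenter: "recenter (recenter f c) e = recenter f (c + e)"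
  by (simp add: pcompose_assoc[symmetric] pcompose_pCons)

lemma recenter_eq_0_iff [simp]: "recenter f c = 0 \<longleftrightarrow> f = 0"
  by (simp add: pcompose_eq_0_iff)

text \<open>Coefficients beyond the degree vanish and have value \<open>Infty\<close>, so the
  minimum up to the degree may be tested over all indices.\<close>

lemma ball_valuation_ge_iff:
  "z \<le> ball_valuation v c \<delta> f \<longleftrightarrow>
     (\<forall>k. z \<le> v (coeff (recenter f c) k) + Fin (nat_mult k \<delta>))"
proof -
  let ?t = "\<lambda>k. v (coeff (recenter f c) k) + Fin (nat_mult k \<delta>)"
  have "degree (recenter f c) = degree f" by (simp add: degree_pcompose)
  then have "z \<le> ?t k" if "\<not> k \<le> degree f" for k
    using that by (simp add: coeff_eq_0)
  moreover have "z \<le> ball_valuation v c \<delta> f \<longleftrightarrow> (\<forall>k\<le>degree f. z \<le> ?t k)"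
    unfolding ball_valuation_def by (subst Min_ge_iff) auto
  ultimately show ?thesis by blast
qed

lemma Fin_le_ball_valuation_iff:
  "Fin \<gamma> \<le> ball_valuation v c \<delta> f \<longleftrightarrow> gauss_ge \<delta> \<gamma> (recenter f c)"
  by (simp add: ball_valuation_ge_iff gauss_ge_def)

lemma less_ball_valuationI:
  assumes "\<And>k. z < v (coeff (recenter f c) k) + Fin (nat_mult k \<delta>)"
  shows "z < ball_valuation v c \<delta> f"
  using assms unfolding ball_valuation_def by (subst Min_gr_iff) auto

lemma ball_valuation_eq_Infty_iff [simp]: "ball_valuation v c \<delta> f = Infty \<longleftrightarrow> f = 0"
proof
  assume "ball_valuation v c \<delta> f = Infty"
  then have "Infty \<le> ball_valuation v c \<delta> f" by simp
  then have "coeff (recenter f c) k = 0" for k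
    unfolding ball_valuation_ge_iff by simp
  then have "recenter f c = 0"
    by (intro poly_eqI) simp
  then show "f = 0" by simp
next
  assume "f = 0"
  then have "recenter f c = 0" by simp
  then have "Infty \<le> ball_valuation v c \<delta> f"
    unfolding ball_valuation_ge_iff by simp
  then show "ball_valuation v c \<delta> f = Infty" by simp
qed

text \<open>The expansion at \<open>c'\<close> arises from the one at \<open>c\<close> by
  translating by \<open>c' - c\<close>, of value at least \<open>\<delta>\<close>. Exchanging the
  two centres later turns the inequality into an equality.\<close>

lemma ball_valuation_mono_center:
  assumes "c' \<in> closed_ball v c \<delta>"
  shows "ball_valuation v c \<delta> f \<le> ball_valuation v c' \<delta> f"
proof (cases "ball_valuation v c \<delta> f")
  case (Fin \<gamma>)
  then have "gauss_ge \<delta> \<gamma> (recenter f c)"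
    by (simp flip: Fin_le_ball_valuation_iff)
  then have "gauss_ge \<delta> \<gamma> (recenter (recenter f c) (c' - c))"
    by (rule gauss_ge_translate[rotated]) (use assms in \<open>simp add: closed_ball_def\<close>)
  then show ?thesis
    by (simp add: Fin Fin_le_ball_valuation_iff recenter_recenter)
next
  case Infty
  then have "ball_valuation v c' \<delta> f = Infty" by simp
  then show ?thesis by (simp only: ext_val_less_simps)
qed

lemma closed_ball_sym: "c' \<in> closed_ball v c \<delta> \<longleftrightarrow> c \<in> closed_ball v c' \<delta>"
  by (simp add: closed_ball_def diff_commute)

lemma ball_valuation_cong_center:
  assumes "c' \<in> closed_ball v c \<delta>"
  shows "ball_valuation v c' \<delta> f = ball_valuation v c \<delta> f"
  using assms ball_valuation_mono_center closed_ball_sym by (blast intro: antisym)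

lemma ball_valuation_le_value: "ball_valuation v c \<delta> f \<le> v (poly f c)"
proof -
  have "ball_valuation v c \<delta> f \<le> v (coeff (recenter f c) 0) + Fin (nat_mult 0 \<delta>)"
    using ball_valuation_ge_iff by blast
  moreover have "coeff (recenter f c) 0 = poly f c"
    using poly_0_coeff_0[of "recenter f c"] by simp
  moreover have "v (poly f c) + Fin (nat_mult 0 \<delta>) = v (poly f c)"
    by (cases "v (poly f c)") auto
  ultimately show ?thesis by simp
qed

lemma open_ball_subset_closed_ball:
  "c' \<in> open_ball v c \<delta> \<Longrightarrow> c' \<in> closed_ball v c \<delta>"
  by (simp add: open_ball_def closed_ball_def)

lemma center_in_open_ball [simp]: "c \<in> open_ball v c \<delta>"
  by (simp add: open_ball_def)

lemma open_ball_cong_center: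
  assumes "c' \<in> open_ball v c \<delta>" shows "open_ball v c' \<delta> = open_ball v c \<delta>"
proof -
  have *: "Fin \<delta> < v (c' - c)" "Fin \<delta> < v (c - c')"
    using assms diff_commute[of c' c] by (auto simp: open_ball_def)
  show ?thesis
    using add_gt[OF _ *(1), of "b - c'" for b] add_gt[OF _ *(2), of "b - c" for b]
    by (auto simp: open_ball_def)
qed

lemma closed_ball_trans:
  assumes "c \<in> closed_ball v b \<delta>" "b \<in> closed_ball v a \<delta>" shows "c \<in> closed_ball v a \<delta>"
  using add_ge[of "Fin \<delta>" "c - b" "b - a"] assms by (simp add: closed_ball_def)

text \<open>The expansion at the root \<open>c'\<close> has no constant term, so \<open>f\<close>
  takes at \<open>c\<close> the value \<open>e * poly G e\<close> with \<open>e = c - c'\<close>.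
  Dividing by the variable costs \<open>\<delta>\<close>, while the factor \<open>e\<close> gives
  back strictly more.\<close>

lemma ball_valuation_less_value_of_root:
  assumes "c' \<in> open_ball v c \<delta>" "poly f c' = 0" "f \<noteq> 0"
  shows "ball_valuation v c \<delta> f < v (poly f c)"
proof -
  have eq: "ball_valuation v c \<delta> f = ball_valuation v c' \<delta> f"
    using ball_valuation_cong_center[OF open_ball_subset_closed_ball[OF assms(1)]] by simp
  obtain \<gamma> where \<gamma>: "ball_valuation v c' \<delta> f = Fin \<gamma>"
    using assms(3) ball_valuation_eq_Infty_iff[of c' \<delta> f] by (cases "ball_valuation v c' \<delta> f") auto
  define e where "e = c - c'"
  have e: "Fin \<delta> < v e"
    using assms(1) diff_commute[of c' c] by (simp add: e_def open_ball_def)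
  obtain x G where G: "recenter f c' = pCons x G" by (rule pCons_cases)
  have "x = 0"
    using arg_cong[OF G, of "\<lambda>p. poly p 0"] assms(2) by simp
  then have "gauss_ge \<delta> (\<gamma> - \<delta>) G"
    using \<gamma> G Fin_le_ball_valuation_iff[of \<gamma> c' \<delta> f] by (simp add: gauss_ge_pCons)
  \<comment> \<open>Moving the centre by \<open>e\<close> keeps the bound, and
    \<open>poly G e\<close> is the constant term at the new centre.\<close>
  then have "Fin (\<gamma> - \<delta>) \<le> ball_valuation v 0 \<delta> (recenter G e)"
    unfolding Fin_le_ball_valuation_iff recenter_recenter using e
    by (simp add: gauss_ge_translate)
  also have "\<dots> \<le> v (poly G e)"
    using ball_valuation_le_value[of 0 \<delta> "recenter G e"] by simp
  finally have "Fin \<delta> + Fin (\<gamma> - \<delta>) < v e + v (poly G e)"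
    using e by (intro ext_val_add_less_mono) auto
  moreover have "poly f c = e * poly G e"
  proof -
    have "poly f c = poly (recenter f c') e" by (simp add: poly_pcompose e_def)
    then show ?thesis using G \<open>x = 0\<close> by simp
  qed
  ultimately show ?thesis by (simp add: eq \<gamma> mult)
qed

end

section \<open>Location of the roots and dominance of the constant term\<close>

locale valued_alg_closed_field = valued_field v
  for v :: "'l::alg_closed_field \<Rightarrow> 'g::linordered_ab_group_add ext_val"

lemma alg_closed_poly_induct [consumes 1, case_names const factor]:
  fixes F :: "'l::alg_closed_field poly"
  assumes "F \<noteq> 0" "\<And>c. c \<noteq> 0 \<Longrightarrow> P [:c:]"
    and "\<And>d H. H \<noteq> 0 \<Longrightarrow> P H \<Longrightarrow> P ([:- d, 1:] * H)"
  shows "P F"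
  using assms(1)
proof (induction "degree F" arbitrary: F)
  case 0
  then obtain c where "F = [:c:]" by (metis degree_eq_zeroE)
  then show ?case using 0 assms(2) by simp
next
  case (Suc n)
  then obtain d where "poly F d = 0"
    using alg_closed_imp_poly_has_root[of F] by auto
  then obtain H where H: "F = [:- d, 1:] * H" by (metis poly_eq_0_iff_dvd dvdE)
  then have "H \<noteq> 0" using Suc by auto
  then have "degree F = Suc (degree H)" unfolding H by (subst degree_mult_eq) auto
  then show ?case using Suc H \<open>H \<noteq> 0\<close> assms(3) by auto
qed

text \<open>Moves a finite summand across, so that \<open>diff_ge\<close> and \<open>diff_gt\<close>
  apply to bounds shifted by \<open>nat_mult k \<delta>\<close>.\<close>

lemma le_add_Fin_iff:
  fixes z w :: "'g::linordered_ab_group_add ext_val"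
  shows "z \<le> w + Fin g \<longleftrightarrow> z + Fin (- g) \<le> w" "z < w + Fin g \<longleftrightarrow> z + Fin (- g) < w"
  by (cases z; cases w; auto simp: algebra_simps)+

context valued_alg_closed_field
begin

text \<open>A Newton polygon statement, proved by splitting off one root \<open>d\<close> at a time.
  The coefficient of index \<open>Suc j\<close> of \<open>[:- d, 1:] * H\<close> is
  \<open>coeff H j - d * coeff H (Suc j)\<close>, and the induction hypothesis together with
  \<open>v d \<le> Fin \<delta>\<close> bounds both parts from below by the value
  \<open>v d + v (coeff H 0)\<close> of the constant term.\<close>

lemma coeff_0_le_of_roots:
  assumes "F \<noteq> 0" "\<And>d. poly F d = 0 \<Longrightarrow> v d \<le> Fin \<delta>"
  shows "v (coeff F 0) \<le> v (coeff F k) + Fin (nat_mult k \<delta>)"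
  using assms
proof (induction F arbitrary: k rule: alg_closed_poly_induct)
  case (const c)
  then show ?case by (cases k; cases "v c") auto
next
  case (factor d H)
  have H: "v (coeff H 0) \<le> v (coeff H k) + Fin (nat_mult k \<delta>)" for k
    using factor by simp
  have d: "v d \<le> Fin \<delta>" using factor.prems[of d] by simp
  show ?case
  proof (cases k)
    case 0
    then show ?thesis by (cases "v (coeff ([:- d, 1:] * H) 0)") auto
  next
    case (Suc j)
    have "v d + v (coeff H 0) \<le> Fin \<delta> + (v (coeff H j) + Fin (nat_mult j \<delta>))"
      using d H by (intro add_mono)
    also have "\<dots> = v (coeff H j) + Fin (nat_mult k \<delta>)"
      by (cases "v (coeff H j)") (simp_all add: Suc ac_simps)
    finally have 1: "v d + v (coeff H 0) \<le> v (coeff H j) + Fin (nat_mult k \<delta>)" .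
    have "v d + v (coeff H 0) \<le> v d + (v (coeff H k) + Fin (nat_mult k \<delta>))"
      using H by (intro add_left_mono)
    then have 2: "v d + v (coeff H 0) \<le> v (d * coeff H k) + Fin (nat_mult k \<delta>)"
      by (simp add: mult add.assoc)
    have "v d + v (coeff H 0) \<le> v (coeff H j - d * coeff H k) + Fin (nat_mult k \<delta>)"
      using 1 2 unfolding le_add_Fin_iff by (rule diff_ge)
    then show ?thesis by (simp add: Suc mult)
  qed
qed

lemma coeff_0_less_of_roots:
  assumes "F \<noteq> 0" "\<And>d. poly F d = 0 \<Longrightarrow> v d < Fin \<delta>" "k > 0"
  shows "v (coeff F 0) < v (coeff F k) + Fin (nat_mult k \<delta>)"
  using assms
proof (induction F arbitrary: k rule: alg_closed_poly_induct)
  case (const c)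
  then show ?case by (cases k) (auto intro!: neq_Infty_less)
next
  case (factor d H)
  have H: "v (coeff H 0) < v (coeff H k) + Fin (nat_mult k \<delta>)" if "k > 0" for k
    using factor that by simp
  \<comment> \<open>For \<open>k = 1\<close> the preceding index is 0, where only the weak bound on
    \<open>H\<close> holds; strictness then comes from \<open>v d < Fin \<delta>\<close>.\<close>
  have H': "v (coeff H 0) \<le> v (coeff H k) + Fin (nat_mult k \<delta>)" for k
    using factor by (intro coeff_0_le_of_roots) (auto intro: less_imp_le)
  have d: "v d < Fin \<delta>" using factor.prems(1)[of d] by simp
  \<comment> \<open>As \<open>v 0 = Infty\<close>, zero is not a root, so the constant term has
    finite value and addition preserves strict inequalities.\<close>
  have "coeff H 0 \<noteq> 0"
    using factor.prems(1)[of 0] by (auto simp: poly_0_coeff_0)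
  then have fin: "v (coeff H 0) \<noteq> Infty" "v d \<noteq> Infty" using d by auto
  obtain j where Suc: "k = Suc j" using \<open>k > 0\<close> by (cases k) auto
  have "v d + v (coeff H 0) < Fin \<delta> + (v (coeff H j) + Fin (nat_mult j \<delta>))"
    using d H' fin by (intro ext_val_add_less_mono)
  also have "\<dots> = v (coeff H j) + Fin (nat_mult k \<delta>)"
    by (cases "v (coeff H j)") (simp_all add: Suc ac_simps)
  finally have 1: "v d + v (coeff H 0) < v (coeff H j) + Fin (nat_mult k \<delta>)" .
  have "v d + v (coeff H 0) < v d + (v (coeff H k) + Fin (nat_mult k \<delta>))"
    using H[OF \<open>k > 0\<close>] fin by (intro ext_val_add_less_mono) auto
  then have 2: "v d + v (coeff H 0) < v (d * coeff H k) + Fin (nat_mult k \<delta>)"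
    by (simp add: mult add.assoc)
  have "v d + v (coeff H 0) < v (coeff H j - d * coeff H k) + Fin (nat_mult k \<delta>)"
    using 1 2 unfolding le_add_Fin_iff by (rule diff_gt)
  then show ?case by (simp add: Suc mult)
qed

lemma root_recenter: "poly (recenter f c) d = 0 \<longleftrightarrow> poly f (c + d) = 0"
  by (simp add: poly_pcompose)

text \<open>The roots of the recentred polynomial are the differences between the roots of
  \<open>f\<close> and \<open>c\<close>. None has value above \<open>\<delta>\<close>, so the
  constant term \<open>poly f c\<close> attains the minimum.\<close>

lemma ball_valuation_eq_value:
  assumes "f \<noteq> 0" "\<And>d. d \<in> open_ball v c \<delta> \<Longrightarrow> poly f d \<noteq> 0"
  shows "ball_valuation v c \<delta> f = v (poly f c)"
proof (rule antisym[OF ball_valuation_le_value])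
  have "v d \<le> Fin \<delta>" if "poly (recenter f c) d = 0" for d
  proof -
    have "c + d \<notin> open_ball v c \<delta>" using assms(2) that root_recenter by blast
    then show ?thesis by (simp add: open_ball_def not_less)
  qed
  then have "v (coeff (recenter f c) 0) \<le> v (coeff (recenter f c) k) + Fin (nat_mult k \<delta>)" for k
    using assms(1) by (intro coeff_0_le_of_roots) auto
  then show "v (poly f c) \<le> ball_valuation v c \<delta> f"
    using poly_0_coeff_0[of "recenter f c"] by (auto simp: ball_valuation_ge_iff)
qed

text \<open>With no root in the closed ball the constant term is strictly dominant; subtracting it
  leaves only terms of strictly larger value.\<close>

lemma value_less_ball_valuation_diff_const:
  assumes "f \<noteq> 0" "\<And>d. d \<in> closed_ball v c \<delta> \<Longrightarrow> poly f d \<noteq> 0"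
  shows "v (poly f c) < ball_valuation v c \<delta> (f - [:poly f c:])"
proof (rule less_ball_valuationI)
  fix k
  have "v d < Fin \<delta>" if "poly (recenter f c) d = 0" for d
  proof -
    have "c + d \<notin> closed_ball v c \<delta>" using assms(2) that root_recenter by blast
    then show ?thesis by (simp add: closed_ball_def not_le)
  qed
  then have *: "v (coeff (recenter f c) 0) < v (coeff (recenter f c) k) + Fin (nat_mult k \<delta>)"
    if "k > 0" using assms(1) that by (intro coeff_0_less_of_roots) auto
  have c0: "coeff (recenter f c) 0 = poly f c"
    using poly_0_coeff_0[of "recenter f c"] by simp
  \<comment> \<open>The centre lies in its own ball, so it is no root. This settles
    \<open>k = 0\<close>, where the coefficient of the difference is zero.\<close>
  have "v (poly f c) \<noteq> Infty"
    using assms(2)[of c] by (simp add: closed_ball_def)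
  then show "v (poly f c) < v (coeff (recenter (f - [:poly f c:]) c) k) + Fin (nat_mult k \<delta>)"
    using * c0 by (cases k) (auto simp: pcompose_diff intro!: neq_Infty_less)
qed

end

section \<open>Minimal polynomials\<close>

locale field_closure =
  fixes \<iota> :: "'k::field \<Rightarrow> 'l::alg_closed_field"
  assumes closure: "is_algebraic_closure \<iota>"
begin

abbreviation ev :: "'k poly \<Rightarrow> 'l \<Rightarrow> 'l" where
  "ev f c \<equiv> poly (map_poly \<iota> f) c"

lemma hom_1 [simp]: "\<iota> 1 = 1" and hom_add: "\<iota> (x + y) = \<iota> x + \<iota> y"
  and hom_mult: "\<iota> (x * y) = \<iota> x * \<iota> y"
  using closure by (auto simp: is_algebraic_closure_def)

lemma algebraic: "\<exists>p. p \<noteq> 0 \<and> ev p c = 0"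
  using closure by (auto simp: is_algebraic_closure_def)

lemma hom_0 [simp]: "\<iota> 0 = 0"
  using hom_add[of 0 0] by (metis add_0 add_cancel_left_right)

lemma hom_eq_0_iff [simp]: "\<iota> x = 0 \<longleftrightarrow> x = 0"
proof
  assume "\<iota> x = 0"
  then show "x = 0" using hom_mult[of x "inverse x"] by (cases "x = 0") auto
qed simp

lemma hom_sum: "\<iota> (sum f A) = (\<Sum>i\<in>A. \<iota> (f i))"
  by (induction A rule: infinite_finite_induct) (auto simp: hom_add)

lemma map_add: "map_poly \<iota> (f + g) = map_poly \<iota> f + map_poly \<iota> g"
  by (intro poly_eqI) (simp add: coeff_map_poly hom_add)

lemma map_mult: "map_poly \<iota> (f * g) = map_poly \<iota> f * map_poly \<iota> g"
  by (intro poly_eqI) (simp add: coeff_map_poly coeff_mult hom_sum hom_mult)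

lemma map_diff: "map_poly \<iota> (f - g) = map_poly \<iota> f - map_poly \<iota> g"
  using map_add[of "f - g" g] by simp

lemma map_1 [simp]: "map_poly \<iota> 1 = 1"
  by (simp add: map_poly_1')

lemma map_eq_0_iff [simp]: "map_poly \<iota> f = 0 \<longleftrightarrow> f = 0"
  by (simp add: poly_eq_iff coeff_map_poly)

lemma ev_add: "ev (f + g) c = ev f c + ev g c"
  and ev_diff: "ev (f - g) c = ev f c - ev g c"
  and ev_mult: "ev (f * g) c = ev f c * ev g c"
  by (simp_all add: map_add map_diff map_mult)

text \<open>Existence: normalise a nonzero annihilating polynomial of least degree. Uniqueness: the
  difference of two candidates annihilates \<open>c\<close> and has smaller degree, since the
  leading terms cancel.\<close>

lemma ex1_min_poly:
  "\<exists>!p. lead_coeff p = 1 \<and> ev p c = 0 \<and> (\<forall>q. q \<noteq> 0 \<and> ev q c = 0 \<longrightarrow> degree p \<le> degree q)"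
proof (rule ex_ex1I)
  obtain p where p: "p \<noteq> 0" "ev p c = 0" "\<And>q. q \<noteq> 0 \<and> ev q c = 0 \<Longrightarrow> degree p \<le> degree q"
    using ex_has_least_nat[of "\<lambda>p. p \<noteq> 0 \<and> ev p c = 0" _ degree] algebraic by metis
  let ?p = "[:inverse (lead_coeff p):] * p"
  have "lead_coeff ?p = 1" "degree ?p = degree p" using p(1) by auto
  moreover have "ev ?p c = 0" using p(2) by (simp only: ev_mult mult_zero_right)
  moreover have "\<forall>q. q \<noteq> 0 \<and> ev q c = 0 \<longrightarrow> degree ?p \<le> degree q"
    unfolding calculation(2) using p(3) by blast
  ultimately show "\<exists>p. lead_coeff p = 1 \<and> ev p c = 0 \<and>
      (\<forall>q. q \<noteq> 0 \<and> ev q c = 0 \<longrightarrow> degree p \<le> degree q)"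
    by blast
next
  fix p q
  assume p: "lead_coeff p = 1 \<and> ev p c = 0 \<and> (\<forall>q. q \<noteq> 0 \<and> ev q c = 0 \<longrightarrow> degree p \<le> degree q)"
    and q: "lead_coeff q = 1 \<and> ev q c = 0 \<and> (\<forall>p. p \<noteq> 0 \<and> ev p c = 0 \<longrightarrow> degree q \<le> degree p)"
  then have deg: "degree p = degree q" by (metis antisym leading_coeff_0_iff zero_neq_one)
  have "p - q = 0 \<or> degree (p - q) < degree p"
    using p q deg by (intro eq_zero_or_degree_less) (auto intro: degree_diff_le)
  moreover have "ev (p - q) c = 0" using p q by (simp add: ev_diff)
  ultimately have "p - q = 0" using p by (meson not_le)
  then show "p = q" by simp
qed

lemma lead_coeff_min_poly [simp]: "lead_coeff (min_poly \<iota> c) = 1"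
  and ev_min_poly [simp]: "ev (min_poly \<iota> c) c = 0"
  and deg_elt_le: "q \<noteq> 0 \<Longrightarrow> ev q c = 0 \<Longrightarrow> deg_elt \<iota> c \<le> degree q"
  using theI'[OF ex1_min_poly[of c]] unfolding deg_elt_def min_poly_def by auto

lemma min_poly_eqI:
  assumes "lead_coeff p = 1" "ev p c = 0" "degree p \<le> deg_elt \<iota> c"
  shows "min_poly \<iota> c = p"
  unfolding min_poly_def
  using assms deg_elt_le[of _ c] by (intro the1_equality ex1_min_poly) (auto intro: order_trans)

lemma min_poly_neq_0 [simp]: "min_poly \<iota> c \<noteq> 0"
  using lead_coeff_min_poly[of c] by fastforce

lemma ev_neq_0: "q \<noteq> 0 \<Longrightarrow> degree q < deg_elt \<iota> c \<Longrightarrow> ev q c \<noteq> 0"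
  using deg_elt_le by (meson not_le)

lemma deg_elt_pos: "0 < deg_elt \<iota> c"
proof (rule ccontr)
  assume "\<not> 0 < deg_elt \<iota> c"
  then have "min_poly \<iota> c = 1"
    using lead_coeff_min_poly[of c] by (auto simp: deg_elt_def elim!: degree_eq_zeroE)
  then show False using ev_min_poly[of c] by simp
qed

lemma degree_mod_min_poly:
  "f mod min_poly \<iota> c = 0 \<or> degree (f mod min_poly \<iota> c) < deg_elt \<iota> c"
  unfolding deg_elt_def by (rule degree_mod_less) simp

lemma ev_mod_min_poly: "ev (f mod min_poly \<iota> c) c = ev f c"
proof -
  have "ev f c = ev (f div min_poly \<iota> c * min_poly \<iota> c + f mod min_poly \<iota> c) c"
    by (simp only: div_mult_mod_eq)
  then show ?thesis unfolding ev_add ev_mult by simp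
qed

text \<open>A Euclidean descent on the degree of \<open>f\<close>. Constants are inverted directly,
  large degrees are reduced modulo the minimal polynomial, and in between dividing the minimal
  polynomial by \<open>f\<close> passes to a remainder of smaller degree.\<close>

lemma ex_inverse_mod:
  assumes "ev f c \<noteq> 0"
  shows "\<exists>s. degree s < deg_elt \<iota> c \<and> ev (s * f) c = 1"
proof -
  have "\<exists>s. ev (s * f) c = 1"
    using assms
  proof (induction "degree f" arbitrary: f rule: less_induct)
    case less
    have f0: "f \<noteq> 0" using less.prems by auto
    consider "degree f = 0" | "0 < degree f" "degree f < deg_elt \<iota> c" | "deg_elt \<iota> c \<le> degree f"
      by linarith
    then show ?case
    proof cases
      case 1
      then obtain x where "f = [:x:]" by (metis degree_eq_zeroE)
      then have "[:inverse x:] * f = 1" using f0 by simp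
      then show ?thesis by (metis map_1 poly_1)
    next
      case 2
      define Q where "Q = min_poly \<iota> c"
      have Q: "ev Q c = ev (Q div f) c * ev f c + ev (Q mod f) c"
        unfolding ev_mult[symmetric] ev_add[symmetric] by (simp only: div_mult_mod_eq)
      have deg_mod: "degree (Q mod f) < degree f" 
        using degree_mod_less[OF f0, of Q] 2 by (elim disjE) simp_all
      have "degree f < degree Q" using 2 by (simp add: Q_def deg_elt_def)
      \<comment> \<open>The quotient is nonzero of degree below that of \<open>Q\<close>, so it
        cannot vanish at \<open>c\<close>; since \<open>Q\<close> vanishes there, neither can the
        remainder.\<close>
      then have "degree (Q div f) < degree Q" using 2 by (intro degree_div_less) auto
      moreover have "Q div f \<noteq> 0"
      proof
        assume "Q div f = 0"
        then have "Q = Q mod f" using div_mult_mod_eq[of Q f] by simp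
        then show False using deg_mod \<open>degree f < degree Q\<close> by simp
      qed
      ultimately have "ev (Q div f) c \<noteq> 0"
        by (intro ev_neq_0) (auto simp: Q_def deg_elt_def)
      then have r: "ev (Q mod f) c \<noteq> 0"
        using Q less.prems by (auto simp: Q_def)
      obtain s where s: "ev (s * (Q mod f)) c = 1" using less.hyps[OF deg_mod r] by blast
      \<comment> \<open>At \<open>c\<close> the identity \<open>Q = Q div f * f + Q mod f\<close>
        turns an inverse of the remainder into one of \<open>f\<close>, up to sign.\<close>
      have "ev (- (s * (Q div f)) * f) c = 1"
      proof -
        have "s * Q = s * (Q div f * f + Q mod f)" by (simp only: div_mult_mod_eq)
        then have "- (s * (Q div f)) * f = s * (Q mod f) - s * Q"
          by (simp only: distrib_left) (simp add: mult.assoc)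
        then show ?thesis using s by (simp only: ev_diff ev_mult) (simp add: Q_def)
      qed
      then show ?thesis by blast
    next
      case 3
      let ?g = "f mod min_poly \<iota> c"
      have "ev ?g c \<noteq> 0" using less.prems ev_mod_min_poly by simp
      then have "?g \<noteq> 0" by auto
      then have "degree ?g < degree f" using degree_mod_min_poly[of f c] 3 by simp
      then obtain s where "ev (s * ?g) c = 1" using less.hyps \<open>ev ?g c \<noteq> 0\<close> by blast
      then show ?thesis by (auto simp: ev_mult ev_mod_min_poly)
    qed
  qed
  then obtain s where "ev (s * f) c = 1" by blast
  \<comment> \<open>Reducing the inverse modulo the minimal polynomial leaves its value at
    \<open>c\<close> unchanged and gives the degree bound.\<close>
  then have "ev (s mod min_poly \<iota> c * f) c = 1" by (simp add: ev_mult ev_mod_min_poly)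
  moreover have "degree (s mod min_poly \<iota> c) < deg_elt \<iota> c"
    using degree_mod_min_poly[of s c] deg_elt_pos[of c] by auto
  ultimately show ?thesis by blast
qed

lemma Min_set_nonempty: "S \<noteq> {} \<Longrightarrow> \<exists>c. c \<in> Min_set \<iota> S"
  using Inf_nat_def1[of "deg_elt \<iota> ` S"] by (auto simp: Min_set_def deg_set_def)

lemma Min_set_le: "c \<in> Min_set \<iota> S \<Longrightarrow> d \<in> S \<Longrightarrow> deg_elt \<iota> c \<le> deg_elt \<iota> d"
  by (auto simp: Min_set_def deg_set_def intro!: cInf_lower)

lemma Min_set_mem: "c \<in> Min_set \<iota> S \<Longrightarrow> c \<in> S"
  by (simp add: Min_set_def)

lemma Min_set_no_root:
  "c \<in> Min_set \<iota> S \<Longrightarrow> f \<noteq> 0 \<Longrightarrow> degree f < deg_elt \<iota> c \<Longrightarrow> d \<in> S \<Longrightarrow> ev f d \<noteq> 0"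
  by (meson Min_set_le ev_neq_0 less_le_trans)

end

section \<open>The graded algebra\<close>

abbreviation "lookup \<equiv> Poly_Mapping.lookup"
abbreviation "keys \<equiv> Poly_Mapping.keys"
abbreviation "single \<equiv> Poly_Mapping.single"

text \<open>Two elements of a coset differ by an element of \<open>P\<close>, so a single element of
  \<open>X\<close> already generates the whole coset. This corrects the elementwise sums and
  products of cosets.\<close>

lemma set_plus_absorb:
  fixes X P :: "'a::ab_group_add set"
  assumes "X \<subseteq> x +o P" "X \<noteq> {}"
    and P: "\<And>a b. a \<in> P \<Longrightarrow> b \<in> P \<Longrightarrow> a + b \<in> P" "\<And>a. a \<in> P \<Longrightarrow> - a \<in> P"
  shows "X + P = x +o P"
proof
  show "X + P \<subseteq> x +o P"
  proof
    fix z assume "z \<in> X + P"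
    then obtain y p where "y \<in> X" "p \<in> P" "z = y + p" by (auto elim: set_plus_elim)
    then show "z \<in> x +o P"
      using assms(1) P(1) by (auto simp: elt_set_plus_def add.assoc)
  qed
  show "x +o P \<subseteq> X + P"
  proof
    fix z assume "z \<in> x +o P"
    then obtain p where p: "p \<in> P" "z = x + p" by (auto simp: elt_set_plus_def)
    obtain y where y: "y \<in> X" using assms(2) by blast
    then obtain q where q: "q \<in> P" "y = x + q" using assms(1) by (auto simp: elt_set_plus_def)
    have "p + - q \<in> P" using p q P by blast
    moreover have "z = y + (p + - q)" using p q by simp
    ultimately show "z \<in> X + P" using y by (metis set_plus_intro)
  qed
qed

text \<open>In a group \<open>\<alpha> + \<beta> = \<gamma>\<close> has the single solution
  \<open>\<beta> = \<gamma> - \<alpha>\<close>, which brings the convolution into the form used by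
  \<open>graded_algebra\<close>.\<close>

lemma lookup_mult_group:
  fixes r s :: "'g::ab_group_add \<Rightarrow>\<^sub>0 'r::comm_ring_1"
  shows "lookup (r * s) \<gamma> = (\<Sum>\<alpha>\<in>keys r. lookup r \<alpha> * lookup s (\<gamma> - \<alpha>))"
proof -
  have "lookup (r * s) \<gamma> = Sum_any (\<lambda>\<alpha>. lookup r \<alpha> * Sum_any (\<lambda>\<beta>. lookup s \<beta> when \<gamma> = \<alpha> + \<beta>))"
    by (rule lookup_mult)
  also have "(\<lambda>\<alpha>. Sum_any (\<lambda>\<beta>. lookup s \<beta> when \<gamma> = \<alpha> + \<beta>)) = (\<lambda>\<alpha>. lookup s (\<gamma> - \<alpha>))"
  proof
    fix \<alpha>
    have "(\<gamma> = \<alpha> + \<beta>) = (\<beta> = \<gamma> - \<alpha>)" for \<beta> by (auto simp: algebra_simps)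
    then show "Sum_any (\<lambda>\<beta>. lookup s \<beta> when \<gamma> = \<alpha> + \<beta>) = lookup s (\<gamma> - \<alpha>)"
      by simp
  qed
  also have "Sum_any (\<lambda>\<alpha>. lookup r \<alpha> * lookup s (\<gamma> - \<alpha>)) =
      (\<Sum>\<alpha>\<in>keys r. lookup r \<alpha> * lookup s (\<gamma> - \<alpha>))"
    by (rule Sum_any.expand_superset) (auto simp: in_keys_iff)
  finally show ?thesis .
qed

lemma lookup_mult_single:
  fixes s :: "'g::ab_group_add \<Rightarrow>\<^sub>0 'r::comm_ring_1"
  shows "lookup (s * single \<kappa> \<phi>) \<gamma> = lookup s (\<gamma> - \<kappa>) * \<phi>"
proof -
  have "lookup (single \<kappa> \<phi> * s) \<gamma> = \<phi> * lookup s (\<gamma> - \<kappa>)"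
  proof (cases "\<phi> = 0")
    case False
    then show ?thesis by (simp add: lookup_mult_group)
  qed simp
  then show ?thesis by (simp add: mult.commute)
qed

locale poly_valuation = valued_ring \<mu>
  for \<mu> :: "'k::field poly \<Rightarrow> 'g::linordered_ab_group_add ext_val"
begin

abbreviation "\<Gamma> \<equiv> value_group \<mu>"
abbreviation "P \<equiv> Pge \<mu>"
abbreviation "P' \<equiv> Pgt \<mu>"
abbreviation "G \<equiv> graded_algebra \<mu>"

lemma value_in_value_group: "\<mu> f = Fin \<alpha> \<Longrightarrow> \<alpha> \<in> \<Gamma>"
  unfolding value_group_def using one by (metis (mono_tags, lifting) diff_zero mem_Collect_eq)

lemma zero_in_value_group [simp]: "0 \<in> \<Gamma>"
  using one by (rule value_in_value_group)

lemma value_group_diff: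
  assumes "\<alpha> \<in> \<Gamma>" "\<beta> \<in> \<Gamma>" shows "\<alpha> - \<beta> \<in> \<Gamma>"
proof -
  obtain a b f g where 1: "\<alpha> = a - b" "\<mu> f = Fin a" "\<mu> g = Fin b"
    using assms(1) by (auto simp: value_group_def)
  obtain a' b' f' g' where 2: "\<beta> = a' - b'" "\<mu> f' = Fin a'" "\<mu> g' = Fin b'"
    using assms(2) by (auto simp: value_group_def)
  have "\<mu> (f * g') = Fin (a + b')" "\<mu> (g * f') = Fin (b + a')"
    using 1 2 by (simp_all add: mult)
  moreover have "\<alpha> - \<beta> = (a + b') - (b + a')" using 1 2 by simp
  ultimately show ?thesis unfolding value_group_def by blast
qed

lemma Pge_closed: "f \<in> P \<alpha> \<Longrightarrow> g \<in> P \<alpha> \<Longrightarrow> f + g \<in> P \<alpha>"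
    "f \<in> P \<alpha> \<Longrightarrow> g \<in> P \<alpha> \<Longrightarrow> f - g \<in> P \<alpha>" "f \<in> P \<alpha> \<Longrightarrow> - f \<in> P \<alpha>" "0 \<in> P \<alpha>"
  by (auto simp: Pge_def add_ge diff_ge)

lemma Pgt_closed: "f \<in> P' \<alpha> \<Longrightarrow> g \<in> P' \<alpha> \<Longrightarrow> f + g \<in> P' \<alpha>"
    "f \<in> P' \<alpha> \<Longrightarrow> g \<in> P' \<alpha> \<Longrightarrow> f - g \<in> P' \<alpha>" "f \<in> P' \<alpha> \<Longrightarrow> - f \<in> P' \<alpha>" "0 \<in> P' \<alpha>"
  by (auto simp: Pgt_def add_gt diff_gt)

lemma Pgt_subset_Pge: "f \<in> P' \<alpha> \<Longrightarrow> f \<in> P \<alpha>"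
  by (simp add: Pgt_def Pge_def)

lemma Pgt_sum: "(\<And>i. i \<in> A \<Longrightarrow> f i \<in> P' \<alpha>) \<Longrightarrow> sum f A \<in> P' \<alpha>"
  by (simp add: Pgt_def sum_gt)

lemma Pge_mult:
  assumes "f \<in> P \<alpha>" "g \<in> P \<beta>" "\<gamma> = \<alpha> + \<beta>" shows "f * g \<in> P \<gamma>"
  using assms add_mono[of "Fin \<alpha>" "\<mu> f" "Fin \<beta>" "\<mu> g"] by (simp add: Pge_def mult)

lemma Pgt_mult:
  assumes "f \<in> P' \<alpha>" "g \<in> P \<beta>" "\<gamma> = \<alpha> + \<beta>" shows "f * g \<in> P' \<gamma>" "g * f \<in> P' \<gamma>"
  using assms ext_val_add_less_mono[of "Fin \<alpha>" "\<mu> f" "Fin \<beta>" "\<mu> g"]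
  by (simp_all add: Pge_def Pgt_def mult add.commute)

text \<open>No polynomial has value exactly \<open>\<alpha>\<close>. Hence entries of a
  representative in degrees outside the value group are negligible.\<close>

lemma Pgt_of_not_in_value_group:
  assumes "f \<in> P \<alpha>" "\<alpha> \<notin> \<Gamma>" shows "f \<in> P' \<alpha>"
  using assms value_in_value_group[of f \<alpha>] by (auto simp: Pge_def Pgt_def less_le)

lemma coset_eq_iff: "f +o P' \<alpha> = g +o P' \<alpha> \<longleftrightarrow> f - g \<in> P' \<alpha>"
proof
  assume "f +o P' \<alpha> = g +o P' \<alpha>"
  moreover have "f \<in> f +o P' \<alpha>" using set_plus_intro2[of 0 "P' \<alpha>" f] Pgt_closed(4) by simp
  ultimately show "f - g \<in> P' \<alpha>" by (simp add: set_minus_plus)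
next
  assume fg: "f - g \<in> P' \<alpha>"
  show "f +o P' \<alpha> = g +o P' \<alpha>"
  proof (rule Set.set_eqI)
    fix h
    have "(h - f) + (f - g) = h - g" "(h - g) - (f - g) = h - f" by simp_all
    then have "h - f \<in> P' \<alpha> \<longleftrightarrow> h - g \<in> P' \<alpha>" using fg Pgt_closed(1,2) by metis
    then show "h \<in> f +o P' \<alpha> \<longleftrightarrow> h \<in> g +o P' \<alpha>" by (simp add: set_minus_plus)
  qed
qed

lemma coset_eq_Pgt_iff: "f +o P' \<alpha> = P' \<alpha> \<longleftrightarrow> f \<in> P' \<alpha>"
  using coset_eq_iff[of f \<alpha> 0] by simp

lemma coset_add: "(f +o P' \<alpha>) + (g +o P' \<alpha>) = (f + g) +o P' \<alpha>"
proof -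
  have "P' \<alpha> + P' \<alpha> = 0 +o P' \<alpha>"
    using Pgt_closed(1,3) Pgt_closed(4)[of \<alpha>] by (intro set_plus_absorb) auto
  then show ?thesis by (simp add: set_plus_rearrange)
qed

text \<open>An element of the graded algebra is represented by a finitely supported family of
  polynomials, i.e. by an element of the monoid algebra of \<open>'g\<close> over \<open>'k poly\<close>; the ring
  axioms are inherited from there.\<close>

definition reps :: "('g \<Rightarrow>\<^sub>0 'k poly) set" where
  "reps = {r. \<forall>\<alpha>. lookup r \<alpha> \<in> P \<alpha>}"

definition coset_family :: "('g \<Rightarrow>\<^sub>0 'k poly) \<Rightarrow> 'g \<Rightarrow> 'k poly set" where
  "coset_family r = (\<lambda>\<alpha>\<in>\<Gamma>. lookup r \<alpha> +o P' \<alpha>)"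

lemma repsD: "r \<in> reps \<Longrightarrow> lookup r \<alpha> \<in> P \<alpha>"
  by (simp add: reps_def)

lemma reps_zero: "0 \<in> reps"
  by (simp add: reps_def Pge_closed)

lemma reps_single: "f \<in> P \<alpha> \<Longrightarrow> single \<alpha> f \<in> reps"
  by (auto simp: reps_def lookup_single when_def Pge_closed)

lemma reps_one: "1 \<in> reps"
  using reps_single[of 1 0] by (simp add: Pge_def)

lemma reps_add: "r \<in> reps \<Longrightarrow> s \<in> reps \<Longrightarrow> r + s \<in> reps"
  by (simp add: reps_def lookup_add Pge_closed)

lemma reps_uminus: "r \<in> reps \<Longrightarrow> - r \<in> reps"
  by (simp add: reps_def Pge_closed)

lemma reps_mult:
  assumes "r \<in> reps" "s \<in> reps" shows "r * s \<in> reps"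
proof -
  have "lookup r \<alpha> * lookup s (\<gamma> - \<alpha>) \<in> P \<gamma>" for \<alpha> \<gamma>
    using assms by (intro Pge_mult[of _ \<alpha> _ "\<gamma> - \<alpha>"]) (auto simp: repsD)
  then have "(\<Sum>\<alpha>\<in>keys r. lookup r \<alpha> * lookup s (\<gamma> - \<alpha>)) \<in> P \<gamma>" for \<gamma>
    by (simp add: Pge_def sum_ge)
  then show ?thesis
    by (simp add: reps_def lookup_mult_group)
qed

lemmas reps_closed = reps_zero reps_one reps_add reps_uminus reps_mult

lemma coset_family_eq_iff:
  "coset_family r = coset_family s \<longleftrightarrow> (\<forall>\<alpha>\<in>\<Gamma>. lookup r \<alpha> - lookup s \<alpha> \<in> P' \<alpha>)"
  by (auto simp: coset_family_def fun_eq_iff coset_eq_iff)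

lemma Pgt_of_not_in_supp:
  assumes "r \<in> reps" "\<alpha> \<notin> supp \<mu> (coset_family r)" shows "lookup r \<alpha> \<in> P' \<alpha>"
  using assms Pgt_of_not_in_value_group[OF repsD[OF assms(1)]] coset_eq_Pgt_iff
  by (cases "\<alpha> \<in> \<Gamma>") (auto simp: supp_def coset_family_def)

lemma supp_subset_keys: "supp \<mu> (coset_family r) \<subseteq> keys r"
  by (auto simp: supp_def coset_family_def in_keys_iff)

lemma coset_family_in_carrier:
  assumes "r \<in> reps" shows "coset_family r \<in> carrier G"
proof -
  have "finite (supp \<mu> (coset_family r))"
    using supp_subset_keys by (rule finite_subset) simp
  then show ?thesis
    using repsD[OF assms] by (auto simp: graded_algebra_def coset_family_def)
qed

lemma carrier_eq: "carrier G = coset_family ` reps"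
proof
  show "coset_family ` reps \<subseteq> carrier G" using coset_family_in_carrier by blast
  show "carrier G \<subseteq> coset_family ` reps"
  proof
    fix g assume "g \<in> carrier G"
    then have g: "g \<in> (\<Pi>\<^sub>E \<alpha>\<in>\<Gamma>. {f +o P' \<alpha> |f. f \<in> P \<alpha>})" and fin: "finite (supp \<mu> g)"
      by (auto simp: graded_algebra_def)
    have "\<exists>f. f \<in> P \<alpha> \<and> g \<alpha> = f +o P' \<alpha>" if "\<alpha> \<in> \<Gamma>" for \<alpha>
      using PiE_mem[OF g that] by auto
    then obtain F where F: "\<And>\<alpha>. \<alpha> \<in> \<Gamma> \<Longrightarrow> F \<alpha> \<in> P \<alpha> \<and> g \<alpha> = F \<alpha> +o P' \<alpha>" by metis
    \<comment> \<open>Chosen representatives are kept on the support only and replaced by 0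
      elsewhere, which makes the family finitely supported.\<close>
    define r where "r = Abs_poly_mapping (\<lambda>\<alpha>. if \<alpha> \<in> supp \<mu> g then F \<alpha> else 0)"
    have r: "lookup r = (\<lambda>\<alpha>. if \<alpha> \<in> supp \<mu> g then F \<alpha> else 0)"
      unfolding r_def using fin by (intro lookup_Abs_poly_mapping) (auto elim: finite_subset[rotated])
    have "r \<in> reps" using F Pge_closed(4) by (auto simp: reps_def r supp_def)
    moreover have "coset_family r = g"
    proof
      fix \<alpha>
      consider "\<alpha> \<notin> \<Gamma>" | "\<alpha> \<in> \<Gamma>" "\<alpha> \<in> supp \<mu> g" | "\<alpha> \<in> \<Gamma>" "\<alpha> \<notin> supp \<mu> g" by blast
      then show "coset_family r \<alpha> = g \<alpha>"
      proof cases
        case 1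
        then show ?thesis using PiE_arb[OF g 1] by (simp add: coset_family_def)
      next
        case 2
        then show ?thesis using F[of \<alpha>] by (simp add: coset_family_def r)
      next
        case 3
        then have "g \<alpha> = P' \<alpha>" by (simp add: supp_def)
        then show ?thesis using 3 by (simp add: coset_family_def r)
      qed
    qed
    ultimately show "g \<in> coset_family ` reps" by blast
  qed
qed

lemma zero_class: "\<zero>\<^bsub>G\<^esub> = coset_family 0"
  by (auto simp: graded_algebra_def coset_family_def)

lemma one_class: "\<one>\<^bsub>G\<^esub> = coset_family 1"
  by (auto simp: graded_algebra_def coset_family_def lookup_one when_def fun_eq_iff)

lemma add_class: "coset_family r \<oplus>\<^bsub>G\<^esub> coset_family s = coset_family (r + s)"
  by (auto simp: graded_algebra_def coset_family_def lookup_add fun_eq_iff coset_add)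

text \<open>In \<open>(f + x) * (g + y) - f * g = f * y + (x * g + x * y)\<close> every summand
  contains a factor \<open>x\<close> or \<open>y\<close> of strictly larger value.\<close>

lemma mult_coset_subset:
  assumes "f \<in> P \<alpha>" "g \<in> P \<beta>" "\<gamma> = \<alpha> + \<beta>"
  shows "(f +o P' \<alpha>) * (g +o P' \<beta>) \<subseteq> (f * g) +o P' \<gamma>"
proof
  fix z assume "z \<in> (f +o P' \<alpha>) * (g +o P' \<beta>)"
  then obtain x y where xy: "x \<in> P' \<alpha>" "y \<in> P' \<beta>" "z = (f + x) * (g + y)"
    by (auto simp: elt_set_plus_def elim!: set_times_elim)
  have "f * y + (x * g + x * y) \<in> P' \<gamma>"
    using Pgt_mult(2)[OF xy(2) assms(1), of \<gamma>] Pgt_mult(1)[OF xy(1) assms(2,3)]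
      Pgt_mult(1)[OF xy(1) Pgt_subset_Pge[OF xy(2)] assms(3)] assms(3)
    by (simp add: Pgt_closed(1) add.commute)
  moreover have "z - f * g = f * y + (x * g + x * y)" using xy by (simp add: algebra_simps)
  ultimately have "z - f * g \<in> P' \<gamma>" by simp
  then show "z \<in> (f * g) +o P' \<gamma>" by (rule set_minus_imp_plus)
qed

text \<open>Nonemptiness is carried through the induction because \<open>set_plus_absorb\<close>
  asks for it; the empty sum is the set containing only 0.\<close>

lemma sum_coset_subset:
  assumes "\<And>i. i \<in> A \<Longrightarrow> X i \<subseteq> x i +o P' \<gamma> \<and> X i \<noteq> {}"
  shows "(\<Sum>i\<in>A. X i) \<subseteq> (\<Sum>i\<in>A. x i) +o P' \<gamma> \<and> (\<Sum>i\<in>A. X i) \<noteq> {}"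
  using assms
proof (induction A rule: infinite_finite_induct)
  case (insert a A)
  have "X a + sum X A \<subseteq> (x a +o P' \<gamma>) + (sum x A +o P' \<gamma>)"
    using insert by (intro set_plus_mono2) auto
  moreover obtain u w where "u \<in> X a" "w \<in> sum X A" using insert by fastforce
  then have "u + w \<in> X a + sum X A" by (rule set_plus_intro)
  then have "X a + sum X A \<noteq> {}" by blast
  ultimately show ?case using insert by (simp add: coset_add)
qed (use Pgt_closed(4) in \<open>auto simp: set_zero\<close>)

lemma mult_class:
  assumes r: "r \<in> reps" and s: "s \<in> reps"
  shows "coset_family r \<otimes>\<^bsub>G\<^esub> coset_family s = coset_family (r * s)"
proof
  fix \<gamma>
  show "(coset_family r \<otimes>\<^bsub>G\<^esub> coset_family s) \<gamma> = coset_family (r * s) \<gamma>"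
  proof (cases "\<gamma> \<in> \<Gamma>")
    case False
    then show ?thesis by (simp add: graded_algebra_def coset_family_def)
  next
    case True
    let ?S = "supp \<mu> (coset_family r)"
    let ?X = "\<lambda>\<alpha>. coset_family r \<alpha> * coset_family s (\<gamma> - \<alpha>)"
    let ?x = "\<lambda>\<alpha>. lookup r \<alpha> * lookup s (\<gamma> - \<alpha>)"
    have "?X \<alpha> \<subseteq> ?x \<alpha> +o P' \<gamma> \<and> ?X \<alpha> \<noteq> {}" if "\<alpha> \<in> ?S" for \<alpha>
    proof
      have "\<alpha> \<in> \<Gamma>" "\<gamma> - \<alpha> \<in> \<Gamma>" using that True value_group_diff by (auto simp: supp_def)
      then have X: "?X \<alpha> = (lookup r \<alpha> +o P' \<alpha>) * (lookup s (\<gamma> - \<alpha>) +o P' (\<gamma> - \<alpha>))"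
        by (simp add: coset_family_def)
      show "?X \<alpha> \<subseteq> ?x \<alpha> +o P' \<gamma>"
        unfolding X using r s by (intro mult_coset_subset) (auto simp: repsD)
      have "lookup r \<alpha> \<in> lookup r \<alpha> +o P' \<alpha>"
        "lookup s (\<gamma> - \<alpha>) \<in> lookup s (\<gamma> - \<alpha>) +o P' (\<gamma> - \<alpha>)"
        by (simp_all add: Pgt_closed flip: set_minus_plus)
      then show "?X \<alpha> \<noteq> {}" unfolding X by blast
    qed
    then have "(\<Sum>\<alpha>\<in>?S. ?X \<alpha>) + P' \<gamma> = (\<Sum>\<alpha>\<in>?S. ?x \<alpha>) +o P' \<gamma>"
      using sum_coset_subset[of ?S ?X ?x \<gamma>] Pgt_closed by (intro set_plus_absorb) auto
    \<comment> \<open>The graded product sums over the support of the class, the monoid algebra over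
      all keys of \<open>r\<close>. Keys outside the support contribute only elements of
      \<open>P' \<gamma>\<close>.\<close>
    also have "\<dots> = (\<Sum>\<alpha>\<in>keys r. ?x \<alpha>) +o P' \<gamma>"
    proof -
      have "?x \<alpha> \<in> P' \<gamma>" if "\<alpha> \<notin> ?S" for \<alpha>
        using Pgt_of_not_in_supp[OF r that] s
        by (intro Pgt_mult(1)[of _ \<alpha> _ "\<gamma> - \<alpha>"]) (auto simp: repsD)
      then have "(\<Sum>\<alpha>\<in>keys r - ?S. ?x \<alpha>) \<in> P' \<gamma>" by (intro Pgt_sum) auto
      moreover have "(\<Sum>\<alpha>\<in>keys r. ?x \<alpha>) = (\<Sum>\<alpha>\<in>keys r - ?S. ?x \<alpha>) + (\<Sum>\<alpha>\<in>?S. ?x \<alpha>)"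
        using supp_subset_keys by (intro sum.subset_diff) auto
      ultimately have "(\<Sum>\<alpha>\<in>keys r. ?x \<alpha>) +o P' \<gamma> = (\<Sum>\<alpha>\<in>?S. ?x \<alpha>) +o P' \<gamma>"
        unfolding coset_eq_iff by simp
      then show ?thesis by simp
    qed
    finally show ?thesis
      using True by (simp add: graded_algebra_def coset_family_def lookup_mult_group)
  qed
qed

lemma carrierE:
  assumes "x \<in> carrier G" obtains r where "r \<in> reps" "x = coset_family r"
  using assms carrier_eq by blast

lemmas class_simps = mult_class add_class zero_class one_class

text \<open>The axioms transfer along \<open>coset_family\<close>, which maps \<open>reps\<close>
  onto the carrier and respects the operations; the class of \<open>- r\<close> is the additive
  inverse.\<close>

lemma cring_graded_algebra: "cring G"
proof (intro cringI abelian_groupI comm_monoidI)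
  fix x assume "x \<in> carrier G"
  then obtain r where r: "r \<in> reps" "x = coset_family r" by (rule carrierE)
  then have "coset_family (- r) \<oplus>\<^bsub>G\<^esub> x = \<zero>\<^bsub>G\<^esub>" by (simp add: class_simps)
  then show "\<exists>y\<in>carrier G. y \<oplus>\<^bsub>G\<^esub> x = \<zero>\<^bsub>G\<^esub>"
    using coset_family_in_carrier[OF reps_uminus[OF r(1)]] by blast
qed ((elim carrierE)?; simp add: class_simps reps_closed coset_family_in_carrier algebra_simps)+

section \<open>Initial forms and the principal ideals they generate\<close>

lemma in_form_class: "\<mu> f = Fin \<alpha> \<Longrightarrow> in_form \<mu> f = coset_family (single \<alpha> f)"
  by (auto simp: in_form_def coset_family_def lookup_single when_def fun_eq_iff)

lemma reps_single_value: "\<mu> f = Fin \<alpha> \<Longrightarrow> single \<alpha> f \<in> reps"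
  by (rule reps_single) (simp add: Pge_def)

lemma in_form_in_carrier: "f \<noteq> 0 \<Longrightarrow> in_form \<mu> f \<in> carrier G"
  using ex_Fin[of f] in_form_class reps_single_value coset_family_in_carrier by metis

lemma in_form_mult:
  assumes "f \<noteq> 0" "g \<noteq> 0"
  shows "in_form \<mu> f \<otimes>\<^bsub>G\<^esub> in_form \<mu> g = in_form \<mu> (f * g)"
proof -
  obtain \<alpha> \<beta> where "\<mu> f = Fin \<alpha>" "\<mu> g = Fin \<beta>" using assms ex_Fin by metis
  then show ?thesis
    by (simp add: in_form_class mult reps_single_value mult_class mult_single)
qed

lemma in_form_cong:
  assumes "\<mu> f < \<mu> (f - g)" shows "in_form \<mu> g = in_form \<mu> f"
proof -
  have "\<mu> g = \<mu> f" using assms by (rule eq_of_diff_gt)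
  moreover obtain \<alpha> where "\<mu> f = Fin \<alpha>" using assms by (cases "\<mu> f") auto
  ultimately show ?thesis
    using assms diff_commute[of f g]
    by (auto simp: in_form_class coset_family_eq_iff lookup_single when_def Pgt_def)
qed

lemma component_class:
  "\<alpha> \<in> \<Gamma> \<Longrightarrow> component \<mu> \<alpha> (coset_family r) = coset_family (single \<alpha> (lookup r \<alpha>))"
  by (auto simp: component_def coset_family_def lookup_single when_def fun_eq_iff)

text \<open>Multiplication by the homogeneous element \<open>single \<kappa> \<phi>\<close> only
  shifts degrees by \<open>\<kappa>\<close>, so membership can be tested in each degree
  separately.\<close>

lemma coset_family_in_PIdl_iff:
  assumes \<phi>: "\<mu> \<phi> = Fin \<kappa>" and r: "r \<in> reps"
  shows "coset_family r \<in> PIdl\<^bsub>G\<^esub> (in_form \<mu> \<phi>) \<longleftrightarrow>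
    (\<forall>\<gamma>\<in>\<Gamma>. \<exists>h\<in>P (\<gamma> - \<kappa>). lookup r \<gamma> - h * \<phi> \<in> P' \<gamma>)"
proof -
  have "coset_family r \<in> PIdl\<^bsub>G\<^esub> (in_form \<mu> \<phi>) \<longleftrightarrow>
      (\<exists>x\<in>carrier G. coset_family r = x \<otimes>\<^bsub>G\<^esub> coset_family (single \<kappa> \<phi>))"
    by (auto simp: cgenideal_def in_form_class[OF \<phi>])
  also have "\<dots> \<longleftrightarrow> (\<exists>s\<in>reps. coset_family r = coset_family (s * single \<kappa> \<phi>))"
    unfolding carrier_eq using mult_class reps_single_value[OF \<phi>] by auto
  also have "\<dots> \<longleftrightarrow> (\<exists>s\<in>reps. \<forall>\<gamma>\<in>\<Gamma>. lookup r \<gamma> - lookup s (\<gamma> - \<kappa>) * \<phi> \<in> P' \<gamma>)"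
    by (simp add: coset_family_eq_iff lookup_mult_single)
  also have "\<dots> \<longleftrightarrow> (\<forall>\<gamma>\<in>\<Gamma>. \<exists>h\<in>P (\<gamma> - \<kappa>). lookup r \<gamma> - h * \<phi> \<in> P' \<gamma>)"
  proof
    assume "\<forall>\<gamma>\<in>\<Gamma>. \<exists>h\<in>P (\<gamma> - \<kappa>). lookup r \<gamma> - h * \<phi> \<in> P' \<gamma>"
    then obtain h where h: "\<And>\<gamma>. \<gamma> \<in> \<Gamma> \<Longrightarrow> h \<gamma> \<in> P (\<gamma> - \<kappa>) \<and> lookup r \<gamma> - h \<gamma> * \<phi> \<in> P' \<gamma>"
      by metis
    \<comment> \<open>The cofactors are retained only over the finitely many degrees where
      \<open>r\<close> is nonzero; elsewhere 0 serves as cofactor.\<close>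
    let ?S = "{\<beta>. \<beta> + \<kappa> \<in> keys r \<inter> \<Gamma>}"
    define s where "s = Abs_poly_mapping (\<lambda>\<beta>. if \<beta> \<in> ?S then h (\<beta> + \<kappa>) else 0)"
    have "?S \<subseteq> (\<lambda>\<gamma>. \<gamma> - \<kappa>) ` keys r" by force
    then have "finite ?S" by (rule finite_subset) simp
    then have s: "lookup s = (\<lambda>\<beta>. if \<beta> \<in> ?S then h (\<beta> + \<kappa>) else 0)"
      unfolding s_def by (intro lookup_Abs_poly_mapping) (auto elim: finite_subset[rotated])
    have "lookup s \<beta> \<in> P \<beta>" for \<beta>
      using h[of "\<beta> + \<kappa>"] Pge_closed(4) by (simp add: s)
    then have "s \<in> reps" by (simp add: reps_def)
    moreover have "lookup r \<gamma> - lookup s (\<gamma> - \<kappa>) * \<phi> \<in> P' \<gamma>" if "\<gamma> \<in> \<Gamma>" for \<gamma>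
      using h[OF that] that Pgt_closed(4) by (auto simp: s in_keys_iff)
    ultimately show "\<exists>s\<in>reps. \<forall>\<gamma>\<in>\<Gamma>. lookup r \<gamma> - lookup s (\<gamma> - \<kappa>) * \<phi> \<in> P' \<gamma>"
      by blast
  qed (use repsD in blast)
  finally show ?thesis .
qed

lemma in_form_in_PIdl_iff:
  assumes \<phi>: "\<mu> \<phi> = Fin \<kappa>" and f: "\<mu> f = Fin \<alpha>"
  shows "in_form \<mu> f \<in> PIdl\<^bsub>G\<^esub> (in_form \<mu> \<phi>) \<longleftrightarrow> (\<exists>h. Fin \<alpha> < \<mu> (f - h * \<phi>))"
proof -
  have "in_form \<mu> f \<in> PIdl\<^bsub>G\<^esub> (in_form \<mu> \<phi>) \<longleftrightarrow>
      (\<forall>\<gamma>\<in>\<Gamma>. \<exists>h\<in>P (\<gamma> - \<kappa>). (f when \<alpha> = \<gamma>) - h * \<phi> \<in> P' \<gamma>)"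
    unfolding in_form_class[OF f] coset_family_in_PIdl_iff[OF \<phi> reps_single_value[OF f]] lookup_single ..
  also have "\<dots> \<longleftrightarrow> (\<exists>h. Fin \<alpha> < \<mu> (f - h * \<phi>))"
  proof
    assume "\<exists>h. Fin \<alpha> < \<mu> (f - h * \<phi>)"
    then obtain h where h: "Fin \<alpha> < \<mu> (f - h * \<phi>)" by blast
    \<comment> \<open>Close approximation forces \<open>h * \<phi>\<close> to have the value of
      \<open>f\<close>, so \<open>h\<close> automatically has the degree required; in all other
      degrees the cofactor 0 works.\<close>
    then have "\<mu> h + Fin \<kappa> = Fin \<alpha>"
      using eq_of_diff_gt[of f "h * \<phi>"] f \<phi> by (simp add: mult)
    then have "\<mu> h = Fin (\<alpha> - \<kappa>)" by (cases "\<mu> h") auto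
    then have "h \<in> P (\<alpha> - \<kappa>)" by (simp add: Pge_def)
    moreover have "f - h * \<phi> \<in> P' \<alpha>" using h by (simp add: Pgt_def)
    moreover have "\<exists>h\<in>P (\<gamma> - \<kappa>). 0 - h * \<phi> \<in> P' \<gamma>" for \<gamma>
      using Pge_closed(4) Pgt_closed(4) by (intro bexI[of _ 0]) auto
    ultimately show "\<forall>\<gamma>\<in>\<Gamma>. \<exists>h\<in>P (\<gamma> - \<kappa>). (f when \<alpha> = \<gamma>) - h * \<phi> \<in> P' \<gamma>"
      by (auto simp only: when_def split: if_split)
  qed (use value_in_value_group[OF f] in \<open>force simp: Pgt_def\<close>)
  finally show ?thesis .
qed

end

text \<open>An abstraction of evaluation at an element \<open>c\<close>: \<open>w f\<close> stands
  for the value of \<open>f\<close> at \<open>c\<close>, possibly \<open>Infty\<close> for nonzero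
  \<open>f\<close>, and \<open>quotient\<close> stands for division by the minimal
  polynomial.\<close>

locale key_criterion = poly_valuation \<mu>
  for \<mu> :: "'k::field poly \<Rightarrow> 'g::linordered_ab_group_add ext_val" +
  fixes w :: "'k poly \<Rightarrow> 'g ext_val" and \<phi> :: "'k poly"
  assumes w_diff: "z < w f \<Longrightarrow> z < w g \<Longrightarrow> z < w (f - g)"
    and w_mult: "w (f * g) = w f + w g"
    and w_one: "w 1 = Fin 0"
    and le_w: "\<mu> f \<le> w f"
    and \<phi>_nonzero: "\<phi> \<noteq> 0"
    and \<phi>_less: "\<mu> \<phi> < w \<phi>"
    and quotient: "\<mu> f < w f \<Longrightarrow> \<exists>h. \<mu> f < \<mu> (f - h * \<phi>)"
begin

lemma w_zero [simp]: "w 0 = Infty"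
  using le_w[of 0] by simp

lemma w_add: "z < w f \<Longrightarrow> z < w g \<Longrightarrow> z < w (f + g)"
  using w_diff[of z f "0 - g"] w_diff[of z 0 g] by (cases z) auto

lemma w_sum: "(\<And>i. i \<in> A \<Longrightarrow> Fin \<gamma> < w (f i)) \<Longrightarrow> Fin \<gamma> < w (sum f A)"
  by (induction A rule: infinite_finite_induct) (auto intro: w_add)

lemma Fin_le_w: "f \<in> P \<alpha> \<Longrightarrow> Fin \<alpha> \<le> w f"
  using le_w order_trans by (auto simp: Pge_def)

text \<open>Multiples of \<open>\<phi>\<close> inherit strictness from
  \<open>\<mu> \<phi> < w \<phi>\<close> by multiplicativity of \<open>w\<close>. Conversely
  \<open>quotient\<close> supplies a cofactor when the component has value exactly
  \<open>\<gamma>\<close>, and 0 does so when its value is larger.\<close>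

lemma coset_family_in_PIdl_iff_less:
  assumes r: "r \<in> reps"
  shows "coset_family r \<in> PIdl\<^bsub>G\<^esub> (in_form \<mu> \<phi>) \<longleftrightarrow> (\<forall>\<gamma>. Fin \<gamma> < w (lookup r \<gamma>))"
proof -
  obtain \<kappa> where \<kappa>: "\<mu> \<phi> = Fin \<kappa>" using ex_Fin[OF \<phi>_nonzero] by blast
  have "(\<exists>h\<in>P (\<gamma> - \<kappa>). f - h * \<phi> \<in> P' \<gamma>) \<longleftrightarrow> Fin \<gamma> < w f" if f: "f \<in> P \<gamma>" for f \<gamma>
  proof
    assume "\<exists>h\<in>P (\<gamma> - \<kappa>). f - h * \<phi> \<in> P' \<gamma>"
    then obtain h where h: "h \<in> P (\<gamma> - \<kappa>)" "Fin \<gamma> < \<mu> (f - h * \<phi>)" by (auto simp: Pgt_def)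
    have "Fin \<kappa> + Fin (\<gamma> - \<kappa>) < w \<phi> + w h"
      using \<phi>_less \<kappa> Fin_le_w[OF h(1)] by (intro ext_val_add_less_mono) auto
    then have 1: "Fin \<gamma> < w (h * \<phi>)" by (simp add: w_mult add.commute)
    have 2: "Fin \<gamma> < w (f - h * \<phi>)" using h(2) le_w by (rule less_le_trans)
    show "Fin \<gamma> < w f" using w_add[OF 2 1] by simp
  next
    assume less: "Fin \<gamma> < w f"
    show "\<exists>h\<in>P (\<gamma> - \<kappa>). f - h * \<phi> \<in> P' \<gamma>"
    proof (cases "\<mu> f = Fin \<gamma>")
      case True
      then obtain h where h: "Fin \<gamma> < \<mu> (f - h * \<phi>)" using quotient[of f] less by auto
      then have "\<mu> h + Fin \<kappa> = Fin \<gamma>"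
        using eq_of_diff_gt[of f "h * \<phi>"] True \<kappa> by (simp add: mult)
      then have "\<mu> h = Fin (\<gamma> - \<kappa>)" by (cases "\<mu> h") auto
      then have "h \<in> P (\<gamma> - \<kappa>)" "f - h * \<phi> \<in> P' \<gamma>" using h by (simp_all add: Pge_def Pgt_def)
      then show ?thesis by blast
    next
      case False
      then have "f - 0 * \<phi> \<in> P' \<gamma>" using f by (simp add: Pge_def Pgt_def less_le)
      then show ?thesis using Pge_closed(4) by blast
    qed
  qed
  then have "coset_family r \<in> PIdl\<^bsub>G\<^esub> (in_form \<mu> \<phi>) \<longleftrightarrow> (\<forall>\<gamma>\<in>\<Gamma>. Fin \<gamma> < w (lookup r \<gamma>))"
    using coset_family_in_PIdl_iff[OF \<kappa> r] repsD[OF r] by simp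
  moreover have "Fin \<gamma> < w (lookup r \<gamma>)" if "\<gamma> \<notin> \<Gamma>" for \<gamma>
    using Pgt_of_not_in_value_group[OF repsD[OF r] that] le_w less_le_trans by (auto simp: Pgt_def)
  ultimately show ?thesis by blast
qed

lemma in_form_in_PIdl_iff_less:
  assumes "f \<noteq> 0"
  shows "in_form \<mu> f \<in> PIdl\<^bsub>G\<^esub> (in_form \<mu> \<phi>) \<longleftrightarrow> \<mu> f < w f"
proof -
  obtain \<alpha> where \<alpha>: "\<mu> f = Fin \<alpha>" using ex_Fin[OF assms] by blast
  show ?thesis
    unfolding in_form_class[OF \<alpha>] coset_family_in_PIdl_iff_less[OF reps_single_value[OF \<alpha>]] \<alpha>
    by (auto simp: lookup_single when_def)
qed

text \<open>The membership criterion is a condition on each degree separately, so it passes to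
  components.\<close>

lemma homogeneous_ideal_PIdl: "homogeneous_ideal \<mu> (PIdl\<^bsub>G\<^esub> (in_form \<mu> \<phi>))"
  unfolding homogeneous_ideal_def
proof (intro conjI ballI)
  interpret cring G by (rule cring_graded_algebra)
  show ideal: "ideal (PIdl\<^bsub>G\<^esub> (in_form \<mu> \<phi>)) G"
    using in_form_in_carrier[OF \<phi>_nonzero] by (rule cgenideal_ideal)
  fix g \<alpha> assume g: "g \<in> PIdl\<^bsub>G\<^esub> (in_form \<mu> \<phi>)" and \<alpha>: "\<alpha> \<in> \<Gamma>"
  have "g \<in> carrier G" using ideal.Icarr[OF ideal g] .
  then obtain r where r: "r \<in> reps" "g = coset_family r" by (rule carrierE)
  then show "component \<mu> \<alpha> g \<in> PIdl\<^bsub>G\<^esub> (in_form \<mu> \<phi>)"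
    using g \<alpha> coset_family_in_PIdl_iff_less[OF r(1)]
      coset_family_in_PIdl_iff_less[OF reps_single[OF repsD[OF r(1)]]]
    by (simp add: component_class lookup_single when_def)
qed

text \<open>Primality is the usual leading term argument: the two components of largest degree that are
  not in the ideal have a product that cannot be cancelled.\<close>

lemma primeideal_PIdl: "primeideal (PIdl\<^bsub>G\<^esub> (in_form \<mu> \<phi>)) G"
proof (rule primeidealI)
  let ?J = "PIdl\<^bsub>G\<^esub> (in_form \<mu> \<phi>)"
  show "ideal ?J G" using homogeneous_ideal_PIdl by (simp add: homogeneous_ideal_def)
  show "cring G" by (rule cring_graded_algebra)
  have "\<not> Fin 0 < w (lookup 1 (0 :: 'g))" by (simp add: w_one)
  then have "coset_family 1 \<notin> ?J" using coset_family_in_PIdl_iff_less[OF reps_one] by blast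
  then show "carrier G \<noteq> ?J" using coset_family_in_carrier[OF reps_one] by blast
  fix x y assume "x \<in> carrier G" "y \<in> carrier G" and xy: "x \<otimes>\<^bsub>G\<^esub> y \<in> ?J"
  then obtain r s where r: "r \<in> reps" "x = coset_family r" and s: "s \<in> reps" "y = coset_family s"
    by (metis carrierE)
  show "x \<in> ?J \<or> y \<in> ?J"
  proof (rule ccontr)
    assume not_in: "\<not> (x \<in> ?J \<or> y \<in> ?J)"
    let ?A = "\<lambda>t. {\<alpha>. \<not> Fin \<alpha> < w (lookup t \<alpha>)}"
    \<comment> \<open>The weak inequality always holds on \<open>reps\<close>, so failure of the
      strict one means equality. Such degrees lie among the finitely many keys, because
      \<open>w 0 = Infty\<close>.\<close>
    have max: "\<exists>a. w (lookup t a) = Fin a \<and> (\<forall>\<alpha>>a. Fin \<alpha> < w (lookup t \<alpha>))"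
      if t: "t \<in> reps" "coset_family t \<notin> ?J" for t
    proof (intro exI conjI allI impI)
      have "?A t \<subseteq> keys t" by (auto simp: in_keys_iff)
      then have fin: "finite (?A t)" by (rule finite_subset) simp
      have "?A t \<noteq> {}" using coset_family_in_PIdl_iff_less[OF t(1)] t(2) by blast
      with fin have "Max (?A t) \<in> ?A t" by (rule Max_in)
      then show "w (lookup t (Max (?A t))) = Fin (Max (?A t))"
        using Fin_le_w[OF repsD[OF t(1), of "Max (?A t)"]] by (auto simp: less_le)
      fix \<alpha> assume "Max (?A t) < \<alpha>"
      then have "\<alpha> \<notin> ?A t" using Max_ge[OF fin] by (meson not_le)
      then show "Fin \<alpha> < w (lookup t \<alpha>)" by simp
    qed
    obtain a where a: "w (lookup r a) = Fin a" "\<And>\<alpha>. \<alpha> > a \<Longrightarrow> Fin \<alpha> < w (lookup r \<alpha>)"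
      using max[of r] r not_in by blast
    obtain b where b: "w (lookup s b) = Fin b" "\<And>\<alpha>. \<alpha> > b \<Longrightarrow> Fin \<alpha> < w (lookup s \<alpha>)"
      using max[of s] s not_in by blast
    let ?x = "\<lambda>\<alpha>. lookup r \<alpha> * lookup s (a + b - \<alpha>)"
    \<comment> \<open>For \<open>\<alpha> \<noteq> a\<close> one of the degrees
      \<open>\<alpha>\<close> and \<open>a + b - \<alpha>\<close> exceeds the corresponding maximum,
      and that factor gives strictness.\<close>
    have "Fin (a + b) < w (?x \<alpha>)" if "\<alpha> \<noteq> a" for \<alpha>
    proof -
      have "Fin \<alpha> + Fin (a + b - \<alpha>) < w (lookup r \<alpha>) + w (lookup s (a + b - \<alpha>))"
      proof (cases "\<alpha> > a")
        case True
        then show ?thesis using a(2) s(1) by (intro ext_val_add_less_mono) (auto simp: repsD Fin_le_w)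
      next
        case False
        then have "a + b - \<alpha> > b" using that by simp
        then show ?thesis using b(2) r(1) by (intro ext_val_add_less_mono) (auto simp: repsD Fin_le_w)
      qed
      then show ?thesis by (simp add: w_mult)
    qed
    then have rest: "Fin (a + b) < w (\<Sum>\<alpha>\<in>keys r - {a}. ?x \<alpha>)" by (intro w_sum) simp
    have "a \<in> keys r" using a(1) by (auto simp: in_keys_iff)
    then have sum: "lookup (r * s) (a + b) = ?x a + (\<Sum>\<alpha>\<in>keys r - {a}. ?x \<alpha>)"
      unfolding lookup_mult_group by (intro sum.remove) auto
    have "coset_family (r * s) \<in> ?J" using xy r s by (simp add: mult_class)
    then have "Fin (a + b) < w (lookup (r * s) (a + b))"
      using coset_family_in_PIdl_iff_less[OF reps_mult[OF r(1) s(1)]] by blast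
    from w_diff[OF this rest] have "Fin (a + b) < w (?x a)" by (simp add: sum)
    then show False using a(1) b(1) by (simp add: w_mult)
  qed
qed

end

section \<open>Key polynomials of the restriction of a ball valuation\<close>

locale restricted_ball_valuation =
  field_closure \<iota> + L: valued_alg_closed_field v + K: poly_valuation \<mu>
  for \<iota> :: "'k::field \<Rightarrow> 'l::alg_closed_field"
    and v :: "'l \<Rightarrow> 'g::linordered_ab_group_add ext_val"
    and \<mu> :: "'k poly \<Rightarrow> 'g ext_val" +
  fixes a :: 'l and \<delta> :: 'g
  assumes restriction: "\<mu> f = ball_valuation v a \<delta> (map_poly \<iota> f)"
begin

lemma restriction_center:
  "c \<in> closed_ball v a \<delta> \<Longrightarrow> \<mu> f = ball_valuation v c \<delta> (map_poly \<iota> f)"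
  using L.ball_valuation_cong_center restriction by simp

lemma le_value: "c \<in> closed_ball v a \<delta> \<Longrightarrow> \<mu> f \<le> v (ev f c)"
  by (simp add: restriction_center L.ball_valuation_le_value)

lemma Min_set_in_closed_ball:
  assumes "b \<in> closed_ball v a \<delta>" "c \<in> Min_set \<iota> (open_ball v b \<delta>)"
  shows "c \<in> closed_ball v a \<delta>" "open_ball v c \<delta> = open_ball v b \<delta>"
proof -
  have c: "c \<in> open_ball v b \<delta>" using assms(2) by (rule Min_set_mem)
  show "c \<in> closed_ball v a \<delta>"
    using L.closed_ball_trans[OF L.open_ball_subset_closed_ball[OF c] assms(1)] .
  show "open_ball v c \<delta> = open_ball v b \<delta>" using c by (rule L.open_ball_cong_center)
qed

text \<open>A nonzero remainder has degree below the minimum over the open ball, hence no root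
  there, so \<open>\<mu>\<close> is its value at \<open>c\<close>; and at \<open>c\<close> the
  remainder agrees with \<open>f\<close>.\<close>

lemma mod_min_poly_value:
  assumes "b \<in> closed_ball v a \<delta>" "c \<in> Min_set \<iota> (open_ball v b \<delta>)"
  shows "\<mu> (f mod min_poly \<iota> c) = v (ev f c)"
proof (cases "f mod min_poly \<iota> c = 0")
  case True
  then show ?thesis using ev_mod_min_poly[of f c] by simp
next
  case False
  then have "degree (f mod min_poly \<iota> c) < deg_elt \<iota> c" using degree_mod_min_poly by blast
  then have "ev (f mod min_poly \<iota> c) d \<noteq> 0" if "d \<in> open_ball v c \<delta>" for d
    using Min_set_no_root[OF assms(2) False] that Min_set_in_closed_ball(2)[OF assms] by simp
  then show ?thesis
    using L.ball_valuation_eq_value[of "map_poly \<iota> (f mod min_poly \<iota> c)" c \<delta>] False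
    by (simp add: restriction_center[OF Min_set_in_closed_ball(1)[OF assms]] ev_mod_min_poly)
qed

lemma is_key_polynomial_min_poly:
  assumes "b \<in> closed_ball v a \<delta>" "c \<in> Min_set \<iota> (open_ball v b \<delta>)"
  shows "is_key_polynomial \<mu> (min_poly \<iota> c)"
proof -
  have c: "c \<in> closed_ball v a \<delta>" using assms by (rule Min_set_in_closed_ball)
  interpret key_criterion \<mu> "\<lambda>f. v (ev f c)" "min_poly \<iota> c"
  proof
    fix f g :: "'k poly" and z
    show "z < v (ev (f - g) c)" if "z < v (ev f c)" "z < v (ev g c)"
      using that by (simp add: ev_diff L.diff_gt)
    show "v (ev (f * g) c) = v (ev f c) + v (ev g c)" by (simp add: ev_mult L.mult)
    show "v (ev 1 c) = Fin 0" by simp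
    show "\<mu> f \<le> v (ev f c)" using c by (rule le_value)
    show "min_poly \<iota> c \<noteq> 0" by simp
    show "\<mu> (min_poly \<iota> c) < v (ev (min_poly \<iota> c) c)" by (simp add: neq_Infty_less)
    \<comment> \<open>With the Euclidean quotient as \<open>h\<close> the difference is the
      remainder, whose \<open>\<mu>\<close>-value is that of \<open>f\<close> at
      \<open>c\<close>.\<close>
    show "\<exists>h. \<mu> f < \<mu> (f - h * min_poly \<iota> c)" if "\<mu> f < v (ev f c)"
      using that mod_min_poly_value[OF assms, of f]
      by (intro exI[of _ "f div min_poly \<iota> c"]) (simp add: minus_div_mult_eq_mod)
  qed
  \<comment> \<open>A polynomial of smaller degree is its own remainder, so equality holds and its
    initial form lies outside the ideal.\<close>
  have "\<not> \<mu> f < v (ev f c)" if "f \<noteq> 0" "degree f < degree (min_poly \<iota> c)" for f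
    using mod_min_poly_value[OF assms, of f] that by (simp add: mod_poly_less)
  then show ?thesis
    unfolding is_key_polynomial_def Let_def
    using homogeneous_ideal_PIdl primeideal_PIdl in_form_in_PIdl_iff_less by simp
qed

section \<open>Roots of key polynomials\<close>

lemma invertible_of_no_root:
  assumes "f \<noteq> 0" "\<And>d. d \<in> closed_ball v a \<delta> \<Longrightarrow> ev f d \<noteq> 0"
  shows "\<exists>s. Fin 0 < \<mu> (1 - s * f)"
proof -
  have "closed_ball v a \<delta> \<noteq> {}"
    using L.open_ball_subset_closed_ball[OF L.center_in_open_ball] by blast
  \<comment> \<open>Minimality is taken over the whole closed ball, so that the inverse
    \<open>s\<close>, of smaller degree, has no root there either.\<close>
  then obtain c where c: "c \<in> Min_set \<iota> (closed_ball v a \<delta>)" using Min_set_nonempty by blast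
  then have c': "c \<in> closed_ball v a \<delta>" by (rule Min_set_mem)
  then obtain s where s: "degree s < deg_elt \<iota> c" "ev (s * f) c = 1"
    using ex_inverse_mod assms(2) by blast
  then have "s \<noteq> 0" by auto
  have "ev (s * f) d \<noteq> 0" if "d \<in> closed_ball v c \<delta>" for d
  proof -
    have d: "d \<in> closed_ball v a \<delta>" using L.closed_ball_trans[OF that c'] .
    then show ?thesis
      using Min_set_no_root[OF c \<open>s \<noteq> 0\<close> s(1) d] assms(2)[OF d] by (simp add: ev_mult)
  qed
  moreover have "map_poly \<iota> (s * f) \<noteq> 0" using s(2) by auto
  ultimately have "v 1 < ball_valuation v c \<delta> (map_poly \<iota> (s * f) - [:1:])"
    using L.value_less_ball_valuation_diff_const[of "map_poly \<iota> (s * f)" c \<delta>] s(2) by simp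
  also have "map_poly \<iota> (s * f) - [:1:] = map_poly \<iota> (s * f - 1)"
    by (simp only: map_diff map_1 one_pCons[symmetric])
  also have "ball_valuation v c \<delta> \<dots> = \<mu> (s * f - 1)" using c' by (rule restriction_center[symmetric])
  also have "\<dots> = \<mu> (1 - s * f)" by (rule K.diff_commute)
  finally show ?thesis by auto
qed

lemma key_polynomial_has_root:
  assumes "is_key_polynomial \<mu> \<phi>"
  shows "\<exists>d\<in>closed_ball v a \<delta>. ev \<phi> d = 0"
proof (rule ccontr)
  let ?J = "PIdl\<^bsub>K.G\<^esub> (in_form \<mu> \<phi>)"
  assume no_root: "\<not> (\<exists>d\<in>closed_ball v a \<delta>. ev \<phi> d = 0)"
  have "lead_coeff \<phi> = 1" and prime: "primeideal ?J K.G"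
    using assms by (auto simp: is_key_polynomial_def Let_def)
  then have "\<phi> \<noteq> 0" by auto
  then obtain \<kappa> where "\<mu> \<phi> = Fin \<kappa>" using K.ex_Fin by blast
  moreover have "\<exists>s. Fin 0 < \<mu> (1 - s * \<phi>)"
    using \<open>\<phi> \<noteq> 0\<close> no_root by (intro invertible_of_no_root) auto
  \<comment> \<open>The initial form of 1 is a multiple of that of \<open>\<phi>\<close>, so the
    ideal is the whole ring and cannot be prime.\<close>
  ultimately have "in_form \<mu> 1 \<in> ?J" by (simp add: K.in_form_in_PIdl_iff)
  moreover have "in_form \<mu> 1 = \<one>\<^bsub>K.G\<^esub>"
    using K.in_form_class[OF K.one] by (simp add: K.one_class)
  moreover have "ideal ?J K.G" using prime by (rule primeideal.axioms)
  ultimately have "?J = carrier K.G" using ideal.one_imp_carrier by metis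
  then show False using primeideal.I_notcarr[OF prime] by simp
qed

lemma key_polynomial_eq_min_poly:
  assumes key: "is_key_polynomial \<mu> \<phi>" and b: "b \<in> closed_ball v a \<delta>"
    and d: "d \<in> open_ball v b \<delta>" "ev \<phi> d = 0"
  shows "d \<in> Min_set \<iota> (open_ball v b \<delta>)" "min_poly \<iota> d = \<phi>"
proof -
  let ?J = "PIdl\<^bsub>K.G\<^esub> (in_form \<mu> \<phi>)"
  interpret cring K.G by (rule K.cring_graded_algebra)
  have lead: "lead_coeff \<phi> = 1" and prime: "primeideal ?J K.G"
    and minimal: "\<And>f. f \<noteq> 0 \<Longrightarrow> degree f < degree \<phi> \<Longrightarrow> in_form \<mu> f \<notin> ?J"
    using key by (auto simp: is_key_polynomial_def Let_def)
  then have \<phi>0: "\<phi> \<noteq> 0" by auto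
  obtain c where c: "c \<in> Min_set \<iota> (open_ball v b \<delta>)" using Min_set_nonempty d(1) by blast
  note c' = Min_set_in_closed_ball[OF b c]
  define Q h where "Q = min_poly \<iota> c" and "h = \<phi> div Q"
  have Q0: "Q \<noteq> 0" by (simp add: Q_def)
  \<comment> \<open>The root \<open>d\<close> lies in the open ball around \<open>c\<close>, which
    forces strictness.\<close>
  have "\<mu> \<phi> < v (ev \<phi> c)"
    unfolding restriction_center[OF c'(1)]
    using d c'(2) \<phi>0 by (intro L.ball_valuation_less_value_of_root) auto
  also have "\<dots> = \<mu> (\<phi> - h * Q)"
    using mod_min_poly_value[OF b c, of \<phi>] by (simp add: h_def Q_def minus_div_mult_eq_mod)
  finally have less: "\<mu> \<phi> < \<mu> (\<phi> - h * Q)" .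
  then have h0: "h \<noteq> 0" by auto
  have "in_form \<mu> h \<otimes>\<^bsub>K.G\<^esub> in_form \<mu> Q = in_form \<mu> \<phi>"
    using K.in_form_mult[OF h0 Q0] K.in_form_cong[OF less] by simp
  then have "in_form \<mu> h \<otimes>\<^bsub>K.G\<^esub> in_form \<mu> Q \<in> ?J"
    using cgenideal_self[OF K.in_form_in_carrier[OF \<phi>0]] by simp
  then have "in_form \<mu> h \<in> ?J \<or> in_form \<mu> Q \<in> ?J"
    using primeideal.I_prime[OF prime] K.in_form_in_carrier h0 Q0 by blast
  \<comment> \<open>\<open>Q\<close> is nonconstant, so the quotient drops in degree; minimality of
    \<open>\<phi>\<close> then excludes \<open>h\<close> from the ideal and leaves
    \<open>Q\<close>.\<close>
  moreover have "degree h < degree \<phi>"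
  proof -
    have "degree \<phi> > 0"
      using deg_elt_le[OF \<phi>0 d(2)] deg_elt_pos[of d] by simp
    then show ?thesis
      unfolding h_def Q_def using deg_elt_pos[of c] by (intro degree_div_less) (simp_all add: deg_elt_def)
  qed
  then have "in_form \<mu> h \<notin> ?J" using minimal h0 by blast
  ultimately have "in_form \<mu> Q \<in> ?J" by blast
  then have deg: "degree \<phi> \<le> deg_elt \<iota> c"
    using minimal[OF Q0] unfolding Q_def deg_elt_def by (meson not_le)
  \<comment> \<open>The chain \<open>deg_elt \<iota> d \<le> degree \<phi> \<le> deg_elt \<iota> c
    \<le> deg_elt \<iota> d\<close> collapses: the outer bounds come from \<open>\<phi>\<close>
    vanishing at \<open>d\<close> and from minimality of \<open>c\<close>.\<close>
  then have eq: "deg_elt \<iota> d = deg_elt \<iota> c"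
    using deg_elt_le[OF \<phi>0 d(2)] Min_set_le[OF c d(1)] by simp
  show "d \<in> Min_set \<iota> (open_ball v b \<delta>)"
    using c d(1) eq by (simp add: Min_set_def)
  show "min_poly \<iota> d = \<phi>"
    using lead d(2) deg eq by (intro min_poly_eqI) simp_all
qed

end

theorem corollary5p6:
  fixes \<iota> :: "'k::field \<Rightarrow> 'l::alg_closed_field"
    and vK :: "'k \<Rightarrow> 'g::linordered_ab_group_add ext_val"
    and v :: "'l \<Rightarrow> 'g ext_val"
    and \<mu> :: "'k poly \<Rightarrow> 'g ext_val"
    and a :: 'l and \<delta> :: 'g
    and I :: "'i set" and as :: "'i \<Rightarrow> 'l"
  assumes closure: "is_algebraic_closure \<iota>"
    and divisible: "\<And>n (\<alpha>::'g). n > 0 \<Longrightarrow> \<exists>\<beta>. nat_mult n \<beta> = \<alpha>"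
    and vK: "valuation vK"
    and v: "valuation v"
    and extends: "\<And>c. v (\<iota> c) = vK c"
    and mu_V: "\<mu> \<in> valuations_over vK"
    and mu_restr: "\<And>f. \<mu> f = ball_valuation v a \<delta> (map_poly \<iota> f)"
    and union: "closed_ball v a \<delta> = (\<Union>i\<in>I. open_ball v (as i) \<delta>)"
    and disjoint: "disjoint_family_on (\<lambda>i. open_ball v (as i) \<delta>) I"
  shows "KP \<mu> = (\<Union>i\<in>I. min_poly \<iota> ` Min_set \<iota> (open_ball v (as i) \<delta>))"
proof -
  interpret restricted_ball_valuation \<iota> v \<mu> a \<delta>
    using closure v mu_V mu_restr by unfold_locales (auto simp: valuations_over_def)
  \<comment> \<open>Each centre lies in its own open ball, which is contained in the union.\<close>
  have centers: "as i \<in> closed_ball v a \<delta>" if "i \<in> I" for i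
    using that union L.center_in_open_ball by blast
  show ?thesis
  proof (intro equalityI subsetI)
    fix \<phi> assume "\<phi> \<in> KP \<mu>"
    then have key: "is_key_polynomial \<mu> \<phi>" by (simp add: KP_def)
    then obtain d where d: "d \<in> closed_ball v a \<delta>" "ev \<phi> d = 0"
      using key_polynomial_has_root by blast
    then obtain i where i: "i \<in> I" "d \<in> open_ball v (as i) \<delta>" using union by blast
    then show "\<phi> \<in> (\<Union>i\<in>I. min_poly \<iota> ` Min_set \<iota> (open_ball v (as i) \<delta>))"
      using key_polynomial_eq_min_poly[OF key centers[OF i(1)] i(2) d(2)] by blast
  next
    fix \<phi> assume "\<phi> \<in> (\<Union>i\<in>I. min_poly \<iota> ` Min_set \<iota> (open_ball v (as i) \<delta>))"
    then show "\<phi> \<in> KP \<mu>"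
      using is_key_polynomial_min_poly centers by (auto simp: KP_def)
  qed
qed

end
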